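(* Let $G$ be a weakly connected oriented graph on $n\ge 2$ vertices that contains cycles, with non-zero edge weights in $\mathbb{C}\setminus\mathbb{R}^-$ and complex signless incidence matrix $N$. (a) If $wt(C)\in\mathbb{R}^+$ for every even cycle $C$ in $G$ and $wt(C)\in\mathbb{R}^-$ for every odd cycle $C$ in $G$, then $$\operatorname{vol}^2(N)=n\sum_{T\in\mathcal{T}(G)}|W_T|,$$ where $\mathcal{T}(G)$ denotes the set of all oriented spanning trees $T$ of $G$. (b) If $G$ contains at least one even cycle $C$ with $wt(C)\notin\mathbb{R}^+$ or at least one odd cycle $C$ with $wt(C)\notin\mathbb{R}^-$, then $$\operatorname{vol}^2(N)=\sum_{H\in\mathcal{U}(G)}\ \prod_{i=1}^{c(H)}2|W_{U_i\setminus C_i}|\cdot\alpha(C_i),$$ where $\mathcal{U}(G)$ denotes the set of all spanning subgraphs $H$ of $G$ whose connected components $U_1,\dots,U_{c(H)}$ are all unicyclic, $C_i$ is the cycle of $U_i$, and $$\alpha(C_i)=\begin{cases}|wt(C_i)|-\operatorname{Re}(wt(C_i)) & \text{if } C_i \text{ is an even cycle},\\ |wt(C_i)|+\operatorname{Re}(wt(C_i)) & \text{if } C_i \text{ is an odd cycle}.\end{cases}$$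
   Context: An oriented graph $G$ is obtained from a finite simple undirected graph $G_u$ (its underlying graph) by giving each edge exactly one direction; it is weakly connected if $G_u$ is connected. Write $V(G)=\{1,\dots,n\}$ and $E(G)=\{e_1,\dots,e_m\}$. Each directed edge $(u,v)$ (from $u$ to $v$) has a non-zero complex weight $w_{uv}$. $\mathbb{R}^+$ and $\mathbb{R}^-$ denote the positive and the negative real numbers, and $\sqrt{\cdot}$ is the principal square root. The complex signless incidence matrix of $G$ is the $n\times m$ matrix $N=(n_{ij})$ where, for $e_j=(u,v)$, $n_{ij}=\sqrt{w_{uv}}$ if $i=u$, $n_{ij}=\sqrt{\overline{w_{uv}}}$ if $i=v$, and $n_{ij}=0$ otherwise. For a complex matrix $A$ of rank $r>0$, $\operatorname{vol}^2(A)$ is the sum of $|\det B|^2$ over all $r\times r$ submatrices $B$ of $A$. Put $a_{ij}=w_{ij}$ if $(i,j)\in E(G)$, $a_{ij}=\overline{w_{ji}}$ if $(j,i)\in E(G)$, and $a_{ij}=0$ otherwise. The weight of a walk $\gamma=(i_1,\dots,i_k)$ in $G_u$ is $wt(\gamma)=\prod_{s=1}^{k-1}a_{i_si_{s+1}}$. A cycle of $G$ means a cycle of $G_u$; $wt(C)$ is the weight of the closed walk going once around $C$ in either direction (the two directions give complex conjugate values, so conditions such as $wt(C)\in\mathbb{R}^\pm$ and the value $\operatorname{Re}(wt(C))$ do not depend on the choice). A unicyclic graph is a (weakly) connected graph with exactly one cycle; a spanning subgraph of $G$ has vertex set $V(G)$. $U_i\setminus C_i$ is obtained from $U_i$ by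 removing the edges of $C_i$, and $W_F$ is the product of all edge weights of an oriented graph $F$ (equal to $1$ if $F$ has no edges). *)

theory Defs
  imports
    Complex_Main
    "Graph_Theory.Graph_Theory"
    "Jordan_Normal_Form.DL_Rank_Submatrix"
begin

section \<open>Oriented graphs\<close>

text \<open>
  An oriented graph is a finite digraph without loops in which no two vertices are joined by arcs
  in both directions. The underlying undirected graph of \<open>G\<close> is represented by the symmetric
  digraph \<^const>\<open>mk_symmetric\<close> \<open>G\<close>.
\<close>

definition oriented_graph :: "'a pair_pre_digraph \<Rightarrow> bool" where
  "oriented_graph G \<longleftrightarrow>
     pair_digraph G \<and> (\<forall>u v. (u, v) \<in> parcs G \<longrightarrow> (v, u) \<notin> parcs G)"

text \<open>
  The constant \<open>connected\<close> of the graph library refers to the underlying undirected graph and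
  excludes the graph without vertices. Its name is qualified because the topological
  \<open>connected\<close> is also in scope.
\<close>

abbreviation weakly_connected :: "'a pair_pre_digraph \<Rightarrow> bool" where
  "weakly_connected G \<equiv> Digraph_Component.connected (with_proj G)"

definition subgraphs_spanning :: "'a pair_pre_digraph \<Rightarrow> 'a pair_pre_digraph set" where
  "subgraphs_spanning G = {H. spanning (with_proj H) (with_proj G)}"

definition weak_components :: "'a pair_pre_digraph \<Rightarrow> 'a pair_pre_digraph set" where
  "weak_components H =
     {U. pre_digraph.max_subgraph (with_proj H) Digraph_Component.connected (with_proj U)}"

subsection \<open>Cycles of the underlying graph\<close>

text \<open>
  A cycle is an oriented subgraph \<open>C\<close>. The closed walks \<open>v\<^sub>1, \<dots>, v\<^sub>k, v\<^sub>1\<close> (with \<open>k \<ge> 3\<close>, so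
  that walking along an edge and back does not count) that go once around \<open>C\<close>, in either direction
  and from any starting vertex, are its traversals. The library's \<open>pre_digraph.cycle\<close> and
  \<open>tree\<close> follow arc directions and accept cycles of length 2, hence they are not used here.
\<close>

definition goes_around :: "'a list \<Rightarrow> 'a pair_pre_digraph \<Rightarrow> bool" where
  "goes_around p C \<longleftrightarrow>
     vwalk p (with_proj (mk_symmetric C)) \<and>
     4 \<le> length p \<and> hd p = last p \<and> distinct (tl p) \<and>
     pverts C = set p \<and>
     parcs (mk_symmetric C) = set (vwalk_arcs p) \<union> (set (vwalk_arcs p))\<inverse>"

definition is_cycle_of :: "'a pair_pre_digraph \<Rightarrow> 'a pair_pre_digraph \<Rightarrow> bool" where
  "is_cycle_of C G \<longleftrightarrow> subgraph (with_proj C) (with_proj G) \<and> (\<exists>p. goes_around p C)"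

abbreviation even_cycle_of :: "'a pair_pre_digraph \<Rightarrow> 'a pair_pre_digraph \<Rightarrow> bool" where
  "even_cycle_of C G \<equiv> is_cycle_of C G \<and> even (card (parcs C))"

abbreviation odd_cycle_of :: "'a pair_pre_digraph \<Rightarrow> 'a pair_pre_digraph \<Rightarrow> bool" where
  "odd_cycle_of C G \<equiv> is_cycle_of C G \<and> odd (card (parcs C))"

definition oriented_spanning_trees :: "'a pair_pre_digraph \<Rightarrow> 'a pair_pre_digraph set" where
  "oriented_spanning_trees G =
     {T \<in> subgraphs_spanning G. weakly_connected T \<and> (\<nexists>C. is_cycle_of C T)}"

definition unicyclic :: "'a pair_pre_digraph \<Rightarrow> bool" where
  "unicyclic U \<longleftrightarrow> weakly_connected U \<and> (\<exists>!C. is_cycle_of C U)"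

definition the_cycle :: "'a pair_pre_digraph \<Rightarrow> 'a pair_pre_digraph" where
  "the_cycle U = (THE C. is_cycle_of C U)"

definition unicyclic_spanning_subgraphs :: "'a pair_pre_digraph \<Rightarrow> 'a pair_pre_digraph set" where
  "unicyclic_spanning_subgraphs G =
     {H \<in> subgraphs_spanning G. \<forall>U \<in> weak_components H. unicyclic U}"

definition remove_edges :: "'a pair_pre_digraph \<Rightarrow> 'a pair_pre_digraph \<Rightarrow> 'a pair_pre_digraph" where
  "remove_edges U C = \<lparr> pverts = pverts U, parcs = parcs U - parcs C \<rparr>"


section \<open>Weights\<close>

definition pos_reals :: "complex set" where
  "pos_reals = complex_of_real ` {0<..}"

definition neg_reals :: "complex set" where
  "neg_reals = complex_of_real ` {..<0}"

definition weight_product :: "('a \<times> 'a \<Rightarrow> complex) \<Rightarrow> 'a pair_pre_digraph \<Rightarrow> complex" where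
  "weight_product w F = (\<Prod>e \<in> parcs F. w e)"

definition adj_weight ::
  "'a pair_pre_digraph \<Rightarrow> ('a \<times> 'a \<Rightarrow> complex) \<Rightarrow> 'a \<Rightarrow> 'a \<Rightarrow> complex" where
  "adj_weight G w i j =
     (if (i, j) \<in> parcs G then w (i, j)
      else if (j, i) \<in> parcs G then cnj (w (j, i))
      else 0)"

definition walk_weight ::
  "'a pair_pre_digraph \<Rightarrow> ('a \<times> 'a \<Rightarrow> complex) \<Rightarrow> 'a list \<Rightarrow> complex" where
  "walk_weight G w p = (\<Prod>s < length p - 1. adj_weight G w (p ! s) (p ! Suc s))"

text \<open>
  Different traversals of \<open>C\<close> give the same or complex conjugate weights; \<open>SOME\<close> picks one of them.
\<close>

definition cycle_weight ::
  "'a pair_pre_digraph \<Rightarrow> ('a \<times> 'a \<Rightarrow> complex) \<Rightarrow> 'a pair_pre_digraph \<Rightarrow> complex" where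
  "cycle_weight G w C = walk_weight G w (SOME p. goes_around p C)"

definition cycle_alpha ::
  "'a pair_pre_digraph \<Rightarrow> ('a \<times> 'a \<Rightarrow> complex) \<Rightarrow> 'a pair_pre_digraph \<Rightarrow> real" where
  "cycle_alpha G w C =
     (if even (card (parcs C))
      then cmod (cycle_weight G w C) - Re (cycle_weight G w C)
      else cmod (cycle_weight G w C) + Re (cycle_weight G w C))"


section \<open>Signless incidence matrix and volume\<close>

text \<open>
  The vertices are \<open>0, \<dots>, n - 1\<close>, since matrix indices start at \<open>0\<close>, and \<open>es\<close> lists the edges
  in the order of the columns.
\<close>

definition signless_incidence :: "nat \<Rightarrow> (nat \<times> nat) list \<Rightarrow> (nat \<times> nat \<Rightarrow> complex) \<Rightarrow> complex mat" where
  "signless_incidence n es w =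
     mat n (length es) (\<lambda>(i, j).
       if i = fst (es ! j) then csqrt (w (es ! j))
       else if i = snd (es ! j) then csqrt (cnj (w (es ! j)))
       else 0)"

text \<open>Meaningful for matrices of positive rank only.\<close>

definition vol2 :: "complex mat \<Rightarrow> real" where
  "vol2 A =
     (let r = vec_space.rank (dim_row A) A in
        \<Sum>I | I \<subseteq> {..<dim_row A} \<and> card I = r.
        \<Sum>J | J \<subseteq> {..<dim_col A} \<and> card J = r.
          (cmod (det (submatrix A I J)))\<^sup>2)"

end

theory Submission
  imports Defs
begin

text \<open>
  The columns of a square minor of the incidence matrix form a set \<open>F\<close> of arcs and its rows are the
  vertices outside a set \<open>R\<close> of roots. Expanding along rows with a single non-zero entry strips off
  pendant vertices, each contributing the weight of its arc. By the handshake lemma, if no such row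
  and no zero row is left, every remaining vertex has degree two, so what remains is a disjoint union
  of cycles, and a cycle \<open>C\<close> contributes \<open>|z \<plusminus> cnj z|\<^sup>2 = 2 \<alpha>(C)\<close> with \<open>z\<^sup>2 = wt(C)\<close>. Hence a minor
  vanishes unless every vertex reaches exactly one root or cycle. For \<open>R = {}\<close> this means that all
  components are unicyclic. If every \<open>\<alpha>(C)\<close> vanishes, then the rank is \<open>n - 1\<close>, and for a single root
  only spanning trees survive, once for each choice of the root. Otherwise a cycle with
  \<open>\<alpha>(C) \<noteq> 0\<close> extends to a connected unicyclic spanning subgraph, so the rank is \<open>n\<close>.
\<close>


section \<open>Cycles of an oriented arc set\<close>

text \<open>Roots are what lets one notion serve both formulas: a root has lost its row, so it can
  carry arcs without a constraint of its own. The handshake argument needs |F| + |R| \<le> |V|. For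
  a minor this is an equality forced by squareness; for an arc set in which every vertex reaches one
  core it has to be derived, from the bound on forests in each component. The arcs of a minor come
  as a set without an order, so its determinant is meaningful only up to sign; therefore every
  statement is about moduli. Off the negative real axis the principal root commutes with
  conjugation, so an arc has conjugate entries at its two ends, and a cycle yields z \<plusminus>
  cnj z. A negative real weight would give equal purely imaginary entries instead and flip the sign
  of the second term. Vertex and arc sets vary separately from the graph record, because stripping
  changes both at every step.\<close>

definition oriented_on :: "'a set \<Rightarrow> 'a rel \<Rightarrow> bool" where
  "oriented_on V F \<longleftrightarrow> finite V \<and> F \<subseteq> V \<times> V \<and> (\<forall>u v. (u, v) \<in> F \<longrightarrow> (v, u) \<notin> F)"

definition incident :: "'a rel \<Rightarrow> 'a \<Rightarrow> 'a rel" where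
  "incident F v = {e \<in> F. fst e = v \<or> snd e = v}"

text \<open>Only the arcs are constrained, so the set of cycles refers to no ambient vertex set and
  can be compared while vertices and arcs are stripped off or attached.\<close>

definition cycles_in :: "'a rel \<Rightarrow> 'a pair_pre_digraph set" where
  "cycles_in F = {C. parcs C \<subseteq> F \<and> (\<exists>p. goes_around p C)}"

abbreviation joined :: "'a rel \<Rightarrow> 'a rel" where
  "joined F \<equiv> (F \<union> F\<inverse>)\<^sup>*"

lemma oriented_on_finite: "oriented_on V F \<Longrightarrow> finite V" "oriented_on V F \<Longrightarrow> finite F"
proof -
  show "oriented_on V F \<Longrightarrow> finite V" by (simp add: oriented_on_def)
  show "oriented_on V F \<Longrightarrow> finite F"
    unfolding oriented_on_def using finite_SigmaI finite_subset by metis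
qed

lemma oriented_on_mono: "oriented_on V F \<Longrightarrow> F' \<subseteq> F \<Longrightarrow> F' \<subseteq> V' \<times> V' \<Longrightarrow> finite V' \<Longrightarrow> oriented_on V' F'"
  unfolding oriented_on_def by blast

lemma oriented_on_noloop: "oriented_on V F \<Longrightarrow> (v, v) \<notin> F"
  unfolding oriented_on_def by blast

lemma vwalk_arcs_zip: "vwalk_arcs p = zip p (tl p)"
  by (induction p rule: vwalk_arcs.induct) auto

lemma set_vwalk_arcs: "set (vwalk_arcs p) = {(p ! i, p ! Suc i) | i. Suc i < length p}"
  unfolding vwalk_arcs_zip set_zip by (force simp: nth_tl)

lemma parcs_mk_symmetric_with_proj: "parcs (mk_symmetric (with_proj C)) = parcs C \<union> (parcs C)\<inverse>"
  by (auto simp: parcs_mk_symmetric)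

lemma goes_around_iff:
  "goes_around p C \<longleftrightarrow> 4 \<le> length p \<and> hd p = last p \<and> distinct (tl p) \<and> pverts C = set p \<and>
     parcs C \<union> (parcs C)\<inverse> = set (vwalk_arcs p) \<union> (set (vwalk_arcs p))\<inverse>"
  unfolding goes_around_def vwalk_def parcs_mk_symmetric_with_proj with_proj_simps
    pverts_mk_symmetric
  by (cases "p = []", simp, blast)

text \<open>Cyclic coordinates: the positions below \<open>k\<close> list every vertex once, and
  \<open>ed i\<close> is the arc of \<open>C\<close> behind step \<open>i\<close>. Orientation makes
  that arc unique, and \<open>k \<ge> 3\<close> keeps two steps from sharing one.\<close>

lemma goes_around_index:
  assumes "goes_around p C" "oriented_on V (parcs C)"
  obtains k ed where "k \<ge> 3" "length p = Suc k" "p ! k = p ! 0" "inj_on ((!) p) {..<k}"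
    "pverts C = (!) p ` {..<k}"
    "\<forall>i<k. ed i = (p ! i, p ! Suc i) \<or> ed i = (p ! Suc i, p ! i)"
    "parcs C = ed ` {..<k}" "inj_on ed {..<k}"
proof -
  define k where "k = length p - 1"
  have ga: "4 \<le> length p" "hd p = last p" "distinct (tl p)" "pverts C = set p"
    and arcs: "parcs C \<union> (parcs C)\<inverse> = set (vwalk_arcs p) \<union> (set (vwalk_arcs p))\<inverse>"
    using assms(1) unfolding goes_around_iff by auto
  have k: "k \<ge> 3" "length p = Suc k" using ga(1) by (auto simp: k_def)
  have wrap: "p ! k = p ! 0"
    using ga(1,2) k by (cases "p = []") (auto simp: hd_conv_nth last_conv_nth)
  have injS: "inj_on ((!) p) {1..k}"
  proof (rule inj_onI)
    fix i j assume "i \<in> {1..k}" "j \<in> {1..k}" "p ! i = p ! j"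
    then have "tl p ! (i - 1) = tl p ! (j - 1)" "i - 1 < length (tl p)" "j - 1 < length (tl p)"
      using k by (auto simp: nth_tl)
    then have "i - 1 = j - 1" using ga(3) nth_eq_iff_index_eq by blast
    then show "i = j" using \<open>i \<in> {1..k}\<close> \<open>j \<in> {1..k}\<close> by auto
  qed
  have inj: "inj_on ((!) p) {..<k}"
  proof (rule inj_onI)
    fix i j assume ij: "i \<in> {..<k}" "j \<in> {..<k}" "p ! i = p ! j"
    \<comment> \<open>\<open>s\<close> moves position 0 to the equal position \<open>k\<close>, into
      the range where distinctness of \<open>tl p\<close> applies.\<close>
    define s where "s = (\<lambda>i. if i = 0 then k else i)"
    have "p ! s i = p ! s j" using ij wrap by (auto simp: s_def)
    moreover have "s i \<in> {1..k}" "s j \<in> {1..k}" using ij k by (auto simp: s_def)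
    ultimately have "s i = s j" using injS by (auto dest: inj_onD)
    then show "i = j" using ij by (auto simp: s_def split: if_splits)
  qed
  have vs: "pverts C = (!) p ` {..<k}"
  proof -
    have "set p = (!) p ` {..<Suc k}" using k(2) by (auto simp: set_conv_nth)
    also have "\<dots> = (!) p ` {..<k}" using wrap k(1) by (auto simp: lessThan_Suc intro!: image_eqI[of _ _ 0])
    finally show ?thesis using ga by simp
  qed
  have "\<exists>e\<in>parcs C. e = (p ! i, p ! Suc i) \<or> e = (p ! Suc i, p ! i)" if "i < k" for i
  proof -
    have "(p ! i, p ! Suc i) \<in> set (vwalk_arcs p)" using that k by (auto simp: set_vwalk_arcs)
    then show ?thesis using arcs by blast
  qed
  then obtain ed where ed: "\<And>i. i < k \<Longrightarrow> ed i \<in> parcs C"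
    "\<And>i. i < k \<Longrightarrow> ed i = (p ! i, p ! Suc i) \<or> ed i = (p ! Suc i, p ! i)" by metis
  have "e \<in> ed ` {..<k}" if "e \<in> parcs C" for e
  proof -
    have "e \<in> set (vwalk_arcs p) \<union> (set (vwalk_arcs p))\<inverse>" using arcs that by blast
    then obtain i where i: "i < k" "e = (p ! i, p ! Suc i) \<or> e = (p ! Suc i, p ! i)"
      using k(2) by (auto simp: set_vwalk_arcs)
    have "ed i = e"
      using ed[OF i(1)] i(2) that assms(2) unfolding oriented_on_def by auto
    then show ?thesis using i(1) by auto
  qed
  then have pc: "parcs C = ed ` {..<k}" using ed by auto
  have injed: "inj_on ed {..<k}"
  proof (rule inj_onI)
    fix i j assume ij: "i \<in> {..<k}" "j \<in> {..<k}" "ed i = ed j"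
    have "(p ! i = p ! j \<and> p ! Suc i = p ! Suc j) \<or> (p ! i = p ! Suc j \<and> p ! Suc i = p ! j)"
      using ed(2)[of i] ed(2)[of j] ij by auto
    \<comment> \<open>An arc used by two steps in opposite directions makes each index the cyclic
      successor of the other, which forces a cycle of length two.\<close>
    moreover have "False" if h: "p ! i = p ! Suc j" "p ! Suc i = p ! j"
    proof -
      have i: "i = (if Suc j = k then 0 else Suc j)"
        using inj_onD[OF inj, of i "if Suc j = k then 0 else Suc j"] h wrap ij by auto
      have j: "j = (if Suc i = k then 0 else Suc i)"
        using inj_onD[OF inj, of j "if Suc i = k then 0 else Suc i"] h wrap ij by auto
      show False
      proof (cases "Suc j = k")
        case True
        then have "i = 0" using i by metis
        then have "j = 1" using j k(1) by (cases "Suc i = k") simp_all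
        then show False using True k(1) by linarith
      next
        case False
        then have "i = Suc j" using i by metis
        moreover have "j = 0 \<or> j = Suc i" using j by metis
        ultimately have "j = 0" "i = 1" by linarith+
        then show False using j k(1) by (cases "Suc i = k") simp_all
      qed
    qed
    ultimately show "i = j" using inj ij by (auto dest: inj_onD)
  qed
  have "\<forall>i<k. ed i = (p ! i, p ! Suc i) \<or> ed i = (p ! Suc i, p ! i)" using ed(2) by simp
  then show thesis by (rule that[OF k wrap inj vs _ pc injed])
qed

lemma cycles_in_orient: "C \<in> cycles_in F \<Longrightarrow> oriented_on V F \<Longrightarrow> oriented_on (pverts C) (parcs C)"
proof -
  assume "C \<in> cycles_in F" "oriented_on V F"
  then obtain p where p: "goes_around p C" "parcs C \<subseteq> F" by (auto simp: cycles_in_def)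
  have "parcs C \<subseteq> set p \<times> set p"
  proof -
    have "set (vwalk_arcs p) \<subseteq> set p \<times> set p" by (auto simp: set_vwalk_arcs)
    then show ?thesis using p(1) unfolding goes_around_iff by blast
  qed
  then show ?thesis using p \<open>oriented_on V F\<close> unfolding goes_around_iff
    by (intro oriented_on_mono[OF \<open>oriented_on V F\<close>]) auto
qed

lemma card_inc_cycle:
  assumes "goes_around p C" "oriented_on V (parcs C)" "v \<in> pverts C"
  shows "card (incident (parcs C) v) = 2"
proof -
  obtain k ed where k: "k \<ge> 3" "length p = Suc k" and wrap: "p ! k = p ! 0"
    and inj: "inj_on ((!) p) {..<k}" and vs: "pverts C = (!) p ` {..<k}"
    and ed': "\<forall>i<k. ed i = (p ! i, p ! Suc i) \<or> ed i = (p ! Suc i, p ! i)"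
    and pc: "parcs C = ed ` {..<k}" and injed: "inj_on ed {..<k}"
    by (rule goes_around_index[OF assms(1,2)])
  have ed: "ed i = (p ! i, p ! Suc i) \<or> ed i = (p ! Suc i, p ! i)" if "i < k" for i
    using ed' that by blast
  obtain i where i: "i < k" "v = p ! i" using assms(3) vs by auto
  \<comment> \<open>\<open>j\<close> is the cyclic predecessor of \<open>i\<close>: steps
    \<open>i\<close> and \<open>j\<close> are the two that meet \<open>v\<close>.\<close>
  define j where "j = (if i = 0 then k - 1 else i - 1)"
  have j: "j < k" "j \<noteq> i" "p ! Suc j = p ! i" using i k wrap by (auto simp: j_def)
  have "incident (parcs C) v = {ed i, ed j}"
  proof (intro equalityI subsetI)
    fix e assume "e \<in> incident (parcs C) v"
    then obtain l where l: "l < k" "e = ed l" "p ! l = v \<or> p ! Suc l = v"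
      using ed unfolding incident_def pc by fastforce
    show "e \<in> {ed i, ed j}"
    proof (cases "p ! l = v")
      case True
      then show ?thesis using l i inj by (auto dest: inj_onD)
    next
      case False
      then have *: "p ! Suc l = p ! i" using l i by auto
      show ?thesis
      proof (cases "Suc l = k")
        case True
        then have "i = 0" using * wrap inj i l by (auto dest: inj_onD)
        then show ?thesis using True l by (auto simp: j_def)
      next
        case False
        then have "Suc l = i" using * inj i l by (auto dest: inj_onD)
        then show ?thesis using l by (auto simp: j_def)
      qed
    qed
  next
    fix e assume "e \<in> {ed i, ed j}"
    then show "e \<in> incident (parcs C) v"
      using ed[OF i(1)] ed[OF j(1)] i j unfolding incident_def pc by auto
  qed
  moreover have "ed i \<noteq> ed j" using injed i j by (auto dest: inj_onD)
  ultimately show ?thesis by simp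
qed

lemma joined_sym: "(u, v) \<in> joined F \<Longrightarrow> (v, u) \<in> joined F"
proof -
  have "sym (joined F)" by (intro sym_rtrancl) (auto simp: sym_def)
  then show "(u, v) \<in> joined F \<Longrightarrow> (v, u) \<in> joined F" by (rule symD)
qed

lemma cycle_connected:
  assumes "goes_around p C" "oriented_on V (parcs C)" "u \<in> pverts C" "v \<in> pverts C"
  shows "(u, v) \<in> joined (parcs C)"
proof -
  obtain k ed where k: "k \<ge> 3" "length p = Suc k" and wrap: "p ! k = p ! 0"
    and inj: "inj_on ((!) p) {..<k}" and vs: "pverts C = (!) p ` {..<k}"
    and ed': "\<forall>i<k. ed i = (p ! i, p ! Suc i) \<or> ed i = (p ! Suc i, p ! i)"
    and pc: "parcs C = ed ` {..<k}" and injed: "inj_on ed {..<k}"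
    by (rule goes_around_index[OF assms(1,2)])
  have ed: "ed i = (p ! i, p ! Suc i) \<or> ed i = (p ! Suc i, p ! i)" if "i < k" for i
    using ed' that by blast
  have *: "i < k \<Longrightarrow> (p ! 0, p ! i) \<in> joined (parcs C)" for i
  proof (induction i)
    case (Suc i)
    then have "ed i \<in> parcs C" using pc by simp
    then have "(p ! i, p ! Suc i) \<in> parcs C \<union> (parcs C)\<inverse>" using ed[of i] Suc.prems by auto
    moreover have "(p ! 0, p ! i) \<in> joined (parcs C)" using Suc by simp
    ultimately show ?case by (rule rtrancl.rtrancl_into_rtrancl[rotated])
  qed simp
  obtain i j where ij: "i < k" "u = p ! i" "j < k" "v = p ! j" using assms vs by auto
  show ?thesis unfolding ij(2,4) by (rule rtrancl_trans[OF joined_sym[OF *[OF ij(1)]] *[OF ij(3)]])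
qed

lemma joined_mono: "F \<subseteq> F' \<Longrightarrow> (u, v) \<in> joined F \<Longrightarrow> (u, v) \<in> joined F'"
proof -
  assume "F \<subseteq> F'"
  then have "joined F \<subseteq> joined F'" by (intro rtrancl_mono) blast
  then show "(u, v) \<in> joined F \<Longrightarrow> (u, v) \<in> joined F'" by blast
qed

text \<open>No arc crosses the boundary of \<open>S\<close>, so a walk that starts inside stays
  inside and uses only arcs with tail in \<open>S\<close>. The second conjunct is what lets
  connectivity pass to a restricted arc set.\<close>

lemma joined_closed:
  assumes "(u, v) \<in> joined F" "u \<in> S" "\<And>x y. (x, y) \<in> F \<Longrightarrow> x \<in> S \<longleftrightarrow> y \<in> S"
  shows "v \<in> S \<and> (u, v) \<in> joined {e \<in> F. fst e \<in> S}"
  using assms(1)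
proof (induction rule: rtrancl_induct)
  case (step y z)
  then have "z \<in> S" using assms(3) by blast
  moreover have "(y, z) \<in> {e \<in> F. fst e \<in> S} \<union> {e \<in> F. fst e \<in> S}\<inverse>"
    using step \<open>z \<in> S\<close> by auto
  ultimately show ?case using step.IH by (meson rtrancl.rtrancl_into_rtrancl)
qed (use assms in auto)

lemma finite_inc: "finite F \<Longrightarrow> finite (incident F v)"
  unfolding incident_def by auto

text \<open>The cycle already occupies two arcs at \<open>v\<close>, so a degree of at most two
  leaves no room for another arc. This separates a cycle from the rest of \<open>F\<close>.\<close>

lemma isolated_cycle:
  assumes "goes_around p C" "parcs C \<subseteq> F" "oriented_on V F"
    and "v \<in> pverts C" "card (incident F v) \<le> 2" "e \<in> incident F v"
  shows "e \<in> parcs C"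
proof -
  have "oriented_on V (parcs C)" using assms unfolding oriented_on_def by blast
  then have "card (incident (parcs C) v) = 2" using card_inc_cycle[OF assms(1)] assms(4) by blast
  moreover have "incident (parcs C) v \<subseteq> incident F v" using assms(2) by (auto simp: incident_def)
  moreover have "finite (incident F v)" using assms(3) by (intro finite_inc oriented_on_finite)
  ultimately have "incident (parcs C) v = incident F v" using assms(5) by (intro card_seteq) auto
  then show ?thesis using assms(6) by (auto simp: incident_def)
qed

text \<open>At each vertex of \<open>C'\<close> both arcs of \<open>C\<close> already belong to
  \<open>C'\<close>, so its vertex set is closed under the arcs of \<open>C\<close>; as
  \<open>C\<close> is connected, it is everything. In particular the arc set determines a
  cycle.\<close>

lemma cycle_within_cycle:
  assumes "goes_around p C" "goes_around p' C'" "oriented_on V (parcs C)" "parcs C' \<subseteq> parcs C"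
  shows "C' = C"
proof -
  have sub: "pverts C' \<subseteq> pverts C"
  proof
    fix v assume v: "v \<in> pverts C'"
    have "oriented_on V (parcs C')" using assms unfolding oriented_on_def by blast
    then have "incident (parcs C') v \<noteq> {}" using card_inc_cycle[OF assms(2) _ v] by fastforce
    then obtain e where "e \<in> parcs C" "fst e = v \<or> snd e = v" using assms(4) by (auto simp: incident_def)
    then have "v \<in> fst ` parcs C \<union> snd ` parcs C" by auto
    moreover have "C \<in> cycles_in (parcs C)" using assms by (auto simp: cycles_in_def)
    then have "oriented_on (pverts C) (parcs C)" using assms(3) cycles_in_orient by blast
    ultimately show "v \<in> pverts C" unfolding oriented_on_def by auto
  qed
  have ne: "pverts C' \<noteq> {}" using assms(2) unfolding goes_around_iff by auto
  then obtain x where x: "x \<in> pverts C'" by auto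
  have iso: "e \<in> parcs C'" if "v \<in> pverts C'" "e \<in> incident (parcs C) v" for v e
    using isolated_cycle[OF assms(2,4,3) that(1) _ that(2)] card_inc_cycle[OF assms(1,3)] that sub by auto
  have "C' \<in> cycles_in (parcs C)" using assms by (auto simp: cycles_in_def)
  then have C'w: "parcs C' \<subseteq> pverts C' \<times> pverts C'" using cycles_in_orient assms(3) unfolding oriented_on_def by blast
  have "C \<in> cycles_in (parcs C)" using assms by (auto simp: cycles_in_def)
  then have Cw: "parcs C \<subseteq> pverts C \<times> pverts C" using cycles_in_orient assms(3) unfolding oriented_on_def by blast
  have "pverts C \<subseteq> pverts C'"
  proof
    fix v assume "v \<in> pverts C"
    then have "(x, v) \<in> joined (parcs C)" using cycle_connected[OF assms(1,3)] x sub by auto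
    then show "v \<in> pverts C'"
    proof (rule joined_closed[THEN conjunct1])
      show "x \<in> pverts C'" by (rule x)
      fix y z assume "(y, z) \<in> parcs C"
      then have "(y, z) \<in> incident (parcs C) y" "(y, z) \<in> incident (parcs C) z" by (auto simp: incident_def)
      then show "y \<in> pverts C' \<longleftrightarrow> z \<in> pverts C'" using iso C'w by blast
    qed
  qed
  then have vv: "pverts C' = pverts C" using sub by auto
  have "parcs C \<subseteq> parcs C'"
  proof
    fix e assume "e \<in> parcs C"
    then show "e \<in> parcs C'" using iso[of "fst e" e] Cw vv by (auto simp: incident_def)
  qed
  then show ?thesis using vv assms(4) by simp
qed

lemma cycle_ex_of_list:
  assumes "oriented_on V F" "distinct q" "3 \<le> length q"
    and adj: "\<And>i. Suc i < length q \<Longrightarrow> (q ! i, q ! Suc i) \<in> F \<union> F\<inverse>"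
    and closing: "(last q, hd q) \<in> F \<union> F\<inverse>"
  shows "\<exists>C\<in>cycles_in F. pverts C = set q"
proof -
  define p where "p = q @ [hd q]"
  define C where "C = \<lparr>pverts = set q, parcs = {e \<in> F. e \<in> set (vwalk_arcs p) \<or> (snd e, fst e) \<in> set (vwalk_arcs p)}\<rparr>"
  have q: "q \<noteq> []" using assms(3) by auto
  have "set (vwalk_arcs p) = insert (last q, hd q) (set (vwalk_arcs q))"
    using q vwalk_arcs_append[of q "[hd q]"] by (simp add: p_def)
  also have "\<dots> \<subseteq> F \<union> F\<inverse>" using adj closing unfolding set_vwalk_arcs by blast
  finally have "parcs C \<union> (parcs C)\<inverse> = set (vwalk_arcs p) \<union> (set (vwalk_arcs p))\<inverse>"
    unfolding C_def by auto
  moreover have "distinct (tl p)" using assms(2) q by (cases q) (auto simp: p_def)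
  ultimately have "goes_around p C"
    using assms(3) q unfolding goes_around_iff by (auto simp: p_def C_def)
  then show ?thesis by (intro bexI[of _ C]) (auto simp: C_def cycles_in_def)
qed

lemma cycle_exists:
  assumes "oriented_on V F" "F \<noteq> {}" "\<And>v. card (incident F v) \<noteq> 1"
  shows "cycles_in F \<noteq> {}"
proof -
  define P where "P = (\<lambda>q. distinct q \<and> set q \<subseteq> V \<and> q \<noteq> [] \<and>
    (\<forall>i. Suc i < length q \<longrightarrow> (q ! i, q ! Suc i) \<in> F \<union> F\<inverse>))"
  have fin: "finite V" "finite F" and FV: "F \<subseteq> V \<times> V"
    using oriented_on_finite[OF assms(1)] assms(1) by (simp_all add: oriented_on_def)
  obtain x y where xy: "(x, y) \<in> F" using assms(2) by auto
  have "P [x, y]" using xy FV oriented_on_noloop[OF assms(1)] by (auto simp: P_def)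
  moreover have "\<And>q. P q \<Longrightarrow> length q \<le> card V"
    using fin by (metis P_def card_mono distinct_card)
  txt \<open>A neighbour of the first vertex of a longest path, other than the second vertex, lies on the path.\<close>
  ultimately obtain q where q: "P q" and mx: "\<And>q'. P q' \<Longrightarrow> length q' \<le> length q"
    using ex_has_greatest_nat[of P "[x, y]" length "Suc (card V)"] by (auto simp: less_Suc_eq_le)
  have l2: "length q \<ge> 2" using mx[OF \<open>P [x, y]\<close>] by simp
  define a b where "a = q ! 0" and "b = q ! 1"
  have ab: "(a, b) \<in> F \<union> F\<inverse>" using q l2 by (auto simp: P_def a_def b_def)
  then obtain e where e: "e \<in> F" "e = (a, b) \<or> e = (b, a)" by auto
  have "e \<in> incident F a" using e by (auto simp: incident_def)
  then have "incident F a \<noteq> {e}" "incident F a \<noteq> {}" using assms(3)[of a] by auto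
  then obtain e' where e': "e' \<in> incident F a" "e' \<noteq> e" by blast
  then obtain z where z: "e' = (a, z) \<or> e' = (z, a)" "e' \<in> F" by (cases e') (auto simp: incident_def)
  have za: "(z, a) \<in> F \<union> F\<inverse>" and "z \<in> V" using z FV by auto
  have "z \<noteq> a" using z oriented_on_noloop[OF assms(1)] by auto
  \<comment> \<open>Otherwise \<open>e\<close> and \<open>e'\<close> would be distinct arcs between
    \<open>a\<close> and \<open>b\<close>, hence opposite ones.\<close>
  have "z \<noteq> b" using z e e' assms(1) unfolding oriented_on_def by auto
  have "z \<in> set q"
  proof (rule ccontr)
    assume "z \<notin> set q"
    moreover have "((z # q) ! i, (z # q) ! Suc i) \<in> F \<union> F\<inverse>" if "Suc i < length (z # q)" for i
      using q za that unfolding P_def a_def by (cases i) auto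
    ultimately have "P (z # q)" using q \<open>z \<in> V\<close> unfolding P_def by simp
    then show False using mx by fastforce
  qed
  then obtain j where j: "j < length q" "q ! j = z" by (auto simp: in_set_conv_nth)
  have "j \<noteq> 0" "j \<noteq> 1" using j \<open>z \<noteq> a\<close> \<open>z \<noteq> b\<close> unfolding a_def b_def by metis+
  then have "j \<ge> 2" by linarith
  \<comment> \<open>The segment from \<open>a\<close> to \<open>z\<close>, closed by the arc between
    them, has at least three vertices because \<open>z\<close> is neither \<open>a\<close> nor
    \<open>b\<close>.\<close>
  have "\<exists>C\<in>cycles_in F. pverts C = set (take (Suc j) q)"
  proof (rule cycle_ex_of_list[OF assms(1)])
    show "distinct (take (Suc j) q)" using q by (simp add: P_def)
    show "3 \<le> length (take (Suc j) q)" using j \<open>j \<ge> 2\<close> by auto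
    show "(take (Suc j) q ! i, take (Suc j) q ! Suc i) \<in> F \<union> F\<inverse>" if "Suc i < length (take (Suc j) q)" for i
      using that q by (auto simp: P_def)
    have "q \<noteq> []" using q by (simp add: P_def)
    then have "hd (take (Suc j) q) = a" by (simp add: a_def hd_conv_nth)
    moreover have "last (take (Suc j) q) = z" using j by (simp add: take_Suc_conv_app_nth)
    ultimately show "(last (take (Suc j) q), hd (take (Suc j) q)) \<in> F \<union> F\<inverse>" using za by simp
  qed
  then show ?thesis by blast
qed


section \<open>Rooted pseudoforests\<close>

text \<open>The rules replay the expansion of a minor backwards: \<open>base\<close> is the empty
  minor, \<open>leaf\<close> restores a row with a single entry, \<open>cycle\<close> restores a
  cyclic block. All roots are present from the start.\<close>

inductive pseudoforest :: "'a set \<Rightarrow> 'a set \<Rightarrow> 'a rel \<Rightarrow> bool" for R where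
  base: "finite R \<Longrightarrow> pseudoforest R R {}"
| leaf: "pseudoforest R V F \<Longrightarrow> v \<notin> V \<Longrightarrow> u \<in> V \<Longrightarrow> e = (u, v) \<or> e = (v, u) \<Longrightarrow>
    pseudoforest R (insert v V) (insert e F)"
| cycle: "pseudoforest R V F \<Longrightarrow> goes_around p C \<Longrightarrow> oriented_on (pverts C) (parcs C) \<Longrightarrow>
    pverts C \<inter> V = {} \<Longrightarrow> pseudoforest R (V \<union> pverts C) (F \<union> parcs C)"

text \<open>Roots become one-vertex graphs, so that roots and cycles are objects of the same type.\<close>

definition cores :: "'a set \<Rightarrow> 'a rel \<Rightarrow> 'a pair_pre_digraph set" where
  "cores R F = (\<lambda>r. \<lparr>pverts = {r}, parcs = {}\<rparr>) ` R \<union> cycles_in F"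

definition reaches :: "'a rel \<Rightarrow> 'a \<Rightarrow> 'a pair_pre_digraph \<Rightarrow> bool" where
  "reaches F v X \<longleftrightarrow> (\<exists>u\<in>pverts X. (v, u) \<in> joined F)"

definition one_core :: "'a set \<Rightarrow> 'a set \<Rightarrow> 'a rel \<Rightarrow> bool" where
  "one_core R V F \<longleftrightarrow> (\<forall>v\<in>V. \<exists>!X. X \<in> cores R F \<and> reaches F v X)"

section \<open>Attaching a pendant arc or a disjoint cycle\<close>

lemma oriented_on_insert:
  assumes "oriented_on V F" "v \<notin> V" "u \<in> V" "e = (u, v) \<or> e = (v, u)"
  shows "oriented_on (insert v V) (insert e F)"
  using assms unfolding oriented_on_def by blast

lemma oriented_on_Un:
  assumes "oriented_on V F" "oriented_on V' F'" "V' \<inter> V = {}"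
  shows "oriented_on (V \<union> V') (F \<union> F')"
  using assms unfolding oriented_on_def by blast

lemma pseudoforest_orient: "pseudoforest R V F \<Longrightarrow> oriented_on V F \<and> R \<subseteq> V"
proof (induction rule: pseudoforest.induct)
  case base
  then show ?case by (simp add: oriented_on_def)
next
  case (leaf V F v u e)
  then show ?case using oriented_on_insert[of V F v u e] by blast
next
  case (cycle V F p C)
  then show ?case using oriented_on_Un[of V F "pverts C" "parcs C"] by blast
qed

lemma cycles_in_mono: "F \<subseteq> F' \<Longrightarrow> cycles_in F \<subseteq> cycles_in F'"
  by (auto simp: cycles_in_def)

lemma cycles_in_parcs_nonempty: "C \<in> cycles_in F \<Longrightarrow> oriented_on V F \<Longrightarrow> parcs C \<noteq> {}"
proof
  assume C: "C \<in> cycles_in F" "oriented_on V F" "parcs C = {}"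
  then obtain p where p: "goes_around p C" by (auto simp: cycles_in_def)
  then obtain v where v: "v \<in> pverts C" unfolding goes_around_iff by (cases p) auto
  show False using card_inc_cycle[OF p cycles_in_orient[OF C(1,2)] v] C(3) by (simp add: incident_def)
qed

lemma cycles_in_empty: "cycles_in {} = {}"
  using cycles_in_parcs_nonempty[of _ "{}" "{}"] by (auto simp: cycles_in_def oriented_on_def)

lemma cycles_in_pverts_nonempty: "C \<in> cycles_in F \<Longrightarrow> pverts C \<noteq> {}"
  by (auto simp: cycles_in_def goes_around_iff)

lemma cycles_in_pverts_subset:
  assumes "C \<in> cycles_in F" "oriented_on V F"
  shows "pverts C \<subseteq> V"
proof
  fix v assume v: "v \<in> pverts C"
  obtain p where p: "goes_around p C" "parcs C \<subseteq> F" using assms(1) by (auto simp: cycles_in_def)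
  have "card (incident (parcs C) v) = 2" by (rule card_inc_cycle[OF p(1) cycles_in_orient[OF assms] v])
  then have "incident (parcs C) v \<noteq> {}" by auto
  then obtain e where "e \<in> F" "fst e = v \<or> snd e = v" using p(2) by (auto simp: incident_def)
  then show "v \<in> V" using assms(2) by (auto simp: oriented_on_def)
qed

lemma cycles_in_connected:
  assumes "C \<in> cycles_in F" "oriented_on V F" "u \<in> pverts C" "v \<in> pverts C"
  shows "(u, v) \<in> joined F"
proof -
  obtain p where p: "goes_around p C" "parcs C \<subseteq> F" using assms(1) by (auto simp: cycles_in_def)
  show ?thesis
    by (rule joined_mono[OF p(2) cycle_connected[OF p(1) cycles_in_orient[OF assms(1,2)] assms(3,4)]])
qed

lemma finite_cycles_in:
  assumes "oriented_on V F"
  shows "finite (cycles_in F)"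
proof -
  have "inj_on parcs (cycles_in F)"
  proof (rule inj_onI)
    fix C C' assume C: "C \<in> cycles_in F" "C' \<in> cycles_in F" "parcs C = parcs C'"
    obtain p p' where p: "goes_around p C" "goes_around p' C'" using C by (auto simp: cycles_in_def)
    have "C' = C" by (rule cycle_within_cycle[OF p cycles_in_orient[OF C(1) assms]]) (use C in simp)
    then show "C = C'" by simp
  qed
  moreover have "parcs ` cycles_in F \<subseteq> Pow F" by (auto simp: cycles_in_def)
  ultimately show ?thesis
    using oriented_on_finite(2)[OF assms] by (meson finite_Pow_iff finite_imageD finite_subset)
qed

lemma reaches_cycle:
  assumes "C \<in> cycles_in F" "oriented_on V F" "reaches F v C" "u \<in> pverts C"
  shows "(v, u) \<in> joined F"
  using assms cycles_in_connected[OF assms(1,2) _ assms(4)] unfolding reaches_def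
  by (meson rtrancl_trans)

lemma pendant_inc:
  assumes "oriented_on V F" "v \<notin> V" "u \<in> V" "e = (u, v) \<or> e = (v, u)"
  shows "incident (insert e F) v = {e}" "e \<notin> F"
  using assms unfolding oriented_on_def incident_def by auto

text \<open>Every vertex of a cycle has degree two in it, whereas \<open>v\<close> has degree one,
  so no cycle passes through \<open>v\<close> or uses \<open>e\<close>.\<close>

lemma pendant_cycles_in:
  assumes "oriented_on V F" "v \<notin> V" "u \<in> V" "e = (u, v) \<or> e = (v, u)"
  shows "cycles_in (insert e F) = cycles_in F"
proof (intro equalityI subsetI)
  fix C assume C: "C \<in> cycles_in (insert e F)"
  then obtain p where p: "goes_around p C" "parcs C \<subseteq> insert e F" by (auto simp: cycles_in_def)
  have o: "oriented_on (insert v V) (insert e F)" by (rule oriented_on_insert[OF assms])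
  have "v \<notin> pverts C"
  proof
    assume v: "v \<in> pverts C"
    have "card (incident (parcs C) v) = 2" by (rule card_inc_cycle[OF p(1) cycles_in_orient[OF C o] v])
    moreover have "incident (parcs C) v \<subseteq> {e}"
      using p(2) pendant_inc(1)[OF assms] by (auto simp: incident_def)
    then have "card (incident (parcs C) v) \<le> card {e}" by (intro card_mono) auto
    ultimately show False by simp
  qed
  then have "e \<notin> parcs C" using cycles_in_orient[OF C o] assms(4) by (auto simp: oriented_on_def)
  then show "C \<in> cycles_in F" using p by (auto simp: cycles_in_def)
qed (use cycles_in_mono[of F "insert e F"] in blast)

text \<open>A walk that enters \<open>v\<close> can leave it only towards \<open>u\<close>. The
  invariant records \<open>u\<close> in place of \<open>v\<close>, so that such excursions
  disappear.\<close>

lemma pendant_conn: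
  assumes "oriented_on V F" "v \<notin> V" "u \<in> V" "e = (u, v) \<or> e = (v, u)"
    and "x \<in> V" "(x, y) \<in> joined (insert e F)"
  shows "(y = v \<longrightarrow> (x, u) \<in> joined F) \<and> (y \<noteq> v \<longrightarrow> (x, y) \<in> joined F)"
  using assms(6)
proof (induction rule: rtrancl_induct)
  case base
  then show ?case using assms(2,5) by auto
next
  case (step y z)
  consider "(y, z) \<in> F \<union> F\<inverse>" | "(y, z) = (u, v) \<or> (y, z) = (v, u)"
    using step.hyps(2) assms(4) by blast
  then show ?case
  proof cases
    case 1
    then have "y \<noteq> v" "z \<noteq> v" using assms(1,2) by (auto simp: oriented_on_def)
    then show ?thesis using step.IH 1 by (auto intro: rtrancl.rtrancl_into_rtrancl)
  next
    case 2
    then show ?thesis using step.IH assms(2,3) by auto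
  qed
qed

lemma cores_pverts_subset:
  assumes "X \<in> cores R F" "oriented_on V F" "R \<subseteq> V"
  shows "pverts X \<subseteq> V"
  using assms(1,3) cycles_in_pverts_subset[OF _ assms(2)] unfolding cores_def by auto

text \<open>Old vertices reach the same cores as before, and \<open>v\<close> reaches exactly what
  \<open>u\<close> reaches. One direction serves to build pseudoforests, the other to strip
  them.\<close>

lemma pendant_one_core:
  assumes "oriented_on V F" "v \<notin> V" "u \<in> V" "e = (u, v) \<or> e = (v, u)" "R \<subseteq> V"
  shows "one_core R (insert v V) (insert e F) \<longleftrightarrow> one_core R V F"
proof -
  have cores: "cores R (insert e F) = cores R F"
    unfolding cores_def pendant_cycles_in[OF assms(1-4)] ..
  have 1: "reaches (insert e F) x X \<longleftrightarrow> reaches F x X" if X: "X \<in> cores R F" and x: "x \<in> V" for x X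
  proof -
    have "v \<notin> pverts X" using cores_pverts_subset[OF X assms(1,5)] assms(2) by auto
    then show ?thesis
      unfolding reaches_def using pendant_conn[OF assms(1-4) x] joined_mono[of F "insert e F"] by blast
  qed
  have uv: "(u, v) \<in> joined (insert e F)" "(v, u) \<in> joined (insert e F)"
    using assms(4) by auto
  have 2: "reaches (insert e F) v X \<longleftrightarrow> reaches (insert e F) u X" for X
    unfolding reaches_def using uv by (meson rtrancl_trans)
  have "(\<exists>!X. X \<in> cores R F \<and> reaches (insert e F) x X) \<longleftrightarrow> (\<exists>!X. X \<in> cores R F \<and> reaches F x X)"
    if "x \<in> V" for x
  proof -
    have "X \<in> cores R F \<and> reaches (insert e F) x X \<longleftrightarrow> X \<in> cores R F \<and> reaches F x X" for X
      using 1[OF _ that] by blast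
    then show ?thesis by simp
  qed
  then show ?thesis unfolding one_core_def cores ball_simps(7) 2 using assms(3) by auto
qed

text \<open>A cycle is connected and no arc joins \<open>V\<close> to \<open>C\<close>, so its arcs
  lie in \<open>F\<close> or in \<open>C\<close>; in the second case it is \<open>C\<close> by
  \<open>cycle_within_cycle\<close>.\<close>

lemma disjoint_cycles_in:
  assumes "oriented_on V F" "goes_around p C" "oriented_on (pverts C) (parcs C)" "pverts C \<inter> V = {}"
  shows "cycles_in (F \<union> parcs C) = insert C (cycles_in F)" "C \<notin> cycles_in F"
proof -
  have o: "oriented_on (V \<union> pverts C) (F \<union> parcs C)" by (rule oriented_on_Un[OF assms(1,3,4)])
  have FV: "F \<subseteq> V \<times> V" and CC: "parcs C \<subseteq> pverts C \<times> pverts C"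
    using assms(1,3) by (auto simp: oriented_on_def)
  have cl: "x \<in> V \<longleftrightarrow> y \<in> V" if "(x, y) \<in> F \<union> parcs C" for x y
    using that FV CC assms(4) by blast
  have "C' \<in> insert C (cycles_in F)" if C': "C' \<in> cycles_in (F \<union> parcs C)" for C'
  proof -
    obtain q where q: "goes_around q C'" "parcs C' \<subseteq> F \<union> parcs C" using C' by (auto simp: cycles_in_def)
    have C'w: "parcs C' \<subseteq> pverts C' \<times> pverts C'" using cycles_in_orient[OF C' o] by (simp add: oriented_on_def)
    obtain x where x: "x \<in> pverts C'" using cycles_in_pverts_nonempty[OF C'] by auto
    have "y \<in> V \<longleftrightarrow> x \<in> V" if "y \<in> pverts C'" for y
      using joined_closed[OF cycles_in_connected[OF C' o x that], of V]
        joined_closed[OF cycles_in_connected[OF C' o that x], of V] cl by blast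
    then consider "pverts C' \<subseteq> V" | "pverts C' \<inter> V = {}" by blast
    then show ?thesis
    proof cases
      case 1
      then have "parcs C' \<subseteq> F" using q(2) C'w CC assms(4) by blast
      then show ?thesis using q(1) by (auto simp: cycles_in_def)
    next
      case 2
      then have "parcs C' \<subseteq> parcs C" using q(2) C'w FV by blast
      then show ?thesis using cycle_within_cycle[OF assms(2) q(1) assms(3)] by simp
    qed
  qed
  then show "cycles_in (F \<union> parcs C) = insert C (cycles_in F)"
    using assms(2) cycles_in_mono[of F "F \<union> parcs C"] by (auto simp: cycles_in_def)
  show "C \<notin> cycles_in F"
  proof
    assume "C \<in> cycles_in F"
    then show False using cycles_in_pverts_subset[OF _ assms(1), of C] cycles_in_pverts_nonempty[of C F] assms(4) by blast
  qed
qed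

text \<open>Vertices of \<open>C\<close> reach the core \<open>C\<close> and no other, while
  vertices of \<open>V\<close> cannot leave \<open>V\<close>.\<close>

lemma disjoint_one_core:
  assumes "oriented_on V F" "goes_around p C" "oriented_on (pverts C) (parcs C)" "pverts C \<inter> V = {}" "R \<subseteq> V"
  shows "one_core R (V \<union> pverts C) (F \<union> parcs C) \<longleftrightarrow> one_core R V F"
proof -
  have cores: "cores R (F \<union> parcs C) = insert C (cores R F)"
    unfolding cores_def disjoint_cycles_in(1)[OF assms(1-4)] by auto
  have FV: "F \<subseteq> V \<times> V" and CC: "parcs C \<subseteq> pverts C \<times> pverts C"
    using assms(1,3) by (auto simp: oriented_on_def)
  have cl: "x \<in> V \<longleftrightarrow> y \<in> V" if "(x, y) \<in> F \<union> parcs C" for x y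
    using that FV CC assms(4) by blast
  have inV: "y \<in> V \<and> (x, y) \<in> joined F" if "x \<in> V" "(x, y) \<in> joined (F \<union> parcs C)" for x y
  proof -
    have sub: "{e \<in> F \<union> parcs C. fst e \<in> V} \<subseteq> F" using CC assms(4) by auto
    have *: "y \<in> V \<and> (x, y) \<in> joined {e \<in> F \<union> parcs C. fst e \<in> V}"
      by (rule joined_closed[OF that(2,1) cl])
    show ?thesis by (rule conjI[OF *[THEN conjunct1] joined_mono[OF sub *[THEN conjunct2]]])
  qed
  have inC: "y \<notin> V" if "x \<in> pverts C" "(x, y) \<in> joined (F \<union> parcs C)" for x y
  proof
    assume "y \<in> V"
    from inV[OF this joined_sym[OF that(2)]] show False using that(1) assms(4) by blast
  qed
  have sub: "pverts X \<subseteq> V" if "X \<in> cores R F" for X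
    by (rule cores_pverts_subset[OF that assms(1,5)])
  have 1: "X \<in> insert C (cores R F) \<and> reaches (F \<union> parcs C) x X \<longleftrightarrow> X \<in> cores R F \<and> reaches F x X"
    if "x \<in> V" for x X
  proof -
    have "reaches (F \<union> parcs C) x X \<longleftrightarrow> reaches F x X"
      unfolding reaches_def using inV[OF that] joined_mono[OF Un_upper1[of F "parcs C"]] by blast
    moreover have "\<not> reaches (F \<union> parcs C) x C"
      unfolding reaches_def using inV[OF that] assms(4) by blast
    ultimately show ?thesis by auto
  qed
  have 2: "X \<in> insert C (cores R F) \<and> reaches (F \<union> parcs C) x X \<longleftrightarrow> X = C"
    if "x \<in> pverts C" for x X
  proof -
    have "\<not> reaches (F \<union> parcs C) x X" if "X \<in> cores R F"
      unfolding reaches_def using inC[OF \<open>x \<in> pverts C\<close>] sub[OF that] by blast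
    moreover have "reaches (F \<union> parcs C) x C" unfolding reaches_def using that by blast
    ultimately show ?thesis by auto
  qed
  have V: "(\<exists>!X. X \<in> insert C (cores R F) \<and> reaches (F \<union> parcs C) x X) \<longleftrightarrow>
      (\<exists>!X. X \<in> cores R F \<and> reaches F x X)" if "x \<in> V" for x
    unfolding 1[OF that] ..
  have "\<exists>!X. X \<in> insert C (cores R F) \<and> reaches (F \<union> parcs C) x X" if "x \<in> pverts C" for x
    unfolding 2[OF that] by simp
  then show ?thesis unfolding one_core_def cores ball_Un by (simp add: ball_Un V del: insert_iff)
qed

lemma pseudoforest_imp_one_core: "pseudoforest R V F \<Longrightarrow> one_core R V F"
proof (induction rule: pseudoforest.induct)
  case base
  show ?case by (auto simp: one_core_def cores_def reaches_def cycles_in_empty)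
next
  case (leaf V F v u e)
  then show ?case using pendant_one_core[of V F v u e R] pseudoforest_orient by blast
next
  case (cycle V F p C)
  then show ?case using disjoint_one_core[of V F p C R] pseudoforest_orient by blast
qed

section \<open>Arc counts and the peeling step\<close>

lemma leaf_split:
  assumes "oriented_on V F" "incident F v = {e}"
  obtains u where "u \<in> V - {v}" "e = (u, v) \<or> e = (v, u)" "oriented_on (V - {v}) (F - {e})"
    "e \<in> F" "v \<in> V"
proof -
  have e: "e \<in> F" "fst e = v \<or> snd e = v" using assms(2) unfolding incident_def by blast+
  define u where "u = (if fst e = v then snd e else fst e)"
  have u: "e = (u, v) \<or> e = (v, u)" using e(2) by (cases e) (auto simp: u_def)
  have "u \<noteq> v" using u e(1) oriented_on_noloop[OF assms(1)] by auto
  moreover have "u \<in> V" "v \<in> V" using u e(1) assms(1) by (auto simp: oriented_on_def)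
  moreover have "F - {e} \<subseteq> (V - {v}) \<times> (V - {v})"
  proof
    fix e' assume e': "e' \<in> F - {e}"
    then have "e' \<notin> incident F v" using assms(2) by auto
    then show "e' \<in> (V - {v}) \<times> (V - {v})" using e' assms(1) by (cases e') (auto simp: incident_def oriented_on_def)
  qed
  then have "oriented_on (V - {v}) (F - {e})" using assms(1) by (auto simp: oriented_on_def)
  ultimately show thesis using that u e(1) by blast
qed

text \<open>Without a cycle some vertex has degree one; removing it with its arc lowers both counts
  by one.\<close>

lemma forest_card:
  assumes "oriented_on V F" "cycles_in F = {}" "V \<noteq> {}"
  shows "card F < card V"
  using assms
proof (induction "card V" arbitrary: V F rule: less_induct)
  case less
  show ?case
  proof (cases "F = {}")
    case True
    then show ?thesis using less.prems oriented_on_finite[OF less.prems(1)] by (simp add: card_gt_0_iff)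
  next
    case False
    then obtain v where "card (incident F v) = 1"
      using cycle_exists[OF less.prems(1)] less.prems(2) by blast
    then obtain e where e: "incident F v = {e}" by (auto simp: card_1_singleton_iff)
    obtain u where u: "u \<in> V - {v}" "oriented_on (V - {v}) (F - {e})" "e \<in> F" "v \<in> V"
      using leaf_split[OF less.prems(1) e] by metis
    have fin: "finite V" "finite F" using oriented_on_finite[OF less.prems(1)] .
    have "card (F - {e}) < card (V - {v})"
    proof (rule less.hyps)
      show "card (V - {v}) < card V" using fin u by (intro psubset_card_mono) auto
      show "cycles_in (F - {e}) = {}" using cycles_in_mono[of "F - {e}" F] less.prems(2) by auto
    qed (use u in auto)
    then show ?thesis using fin u by (simp add: card_Diff_singleton)
  qed
qed

text \<open>A weak component contains a single core. If it is a root, the component is acyclic; if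
  it is a cycle, there is no root, and removing one arc of the cycle leaves a forest. In both cases
  arcs plus roots do not exceed the vertices. The induction removes one component at a time.\<close>

lemma one_core_card:
  assumes "oriented_on V F" "R \<subseteq> V" "one_core R V F"
  shows "card F + card R \<le> card V"
  using assms
proof (induction "card V" arbitrary: V F R rule: less_induct)
  case less
  note o = less.prems(1)
  show ?case
  proof (cases "V = {}")
    case True
    then show ?thesis using less.prems by (auto simp: oriented_on_def)
  next
    case False
    then obtain v where v: "v \<in> V" by auto
    have fin: "finite V" "finite F" "finite R"
      using oriented_on_finite[OF o] finite_subset[OF less.prems(2)] by auto
    have FV: "F \<subseteq> V \<times> V" using o by (simp add: oriented_on_def)
    define U where "U = {u. (v, u) \<in> joined F}"
    define FU where "FU = {e \<in> F. fst e \<in> U}"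
    have cl: "x \<in> U \<longleftrightarrow> y \<in> U" if "(x, y) \<in> F" for x y
    proof -
      have "(x, y) \<in> joined F" "(y, x) \<in> joined F" using that by auto
      then show ?thesis unfolding U_def by (auto intro: rtrancl_trans)
    qed
    have UV: "U \<subseteq> V"
    proof
      fix u assume "u \<in> U"
      then have "(v, u) \<in> joined F" by (simp add: U_def)
      from joined_closed[OF this v] show "u \<in> V" using FV by blast
    qed
    have vU: "v \<in> U" by (simp add: U_def)
    have oU: "oriented_on U FU" using cl o UV fin finite_subset[OF UV] unfolding FU_def oriented_on_def by auto
    have oC: "oriented_on (V - U) (F - FU)"
    proof -
      have "F - FU \<subseteq> (V - U) \<times> (V - U)" using cl FV unfolding FU_def by auto
      then show ?thesis using o unfolding oriented_on_def by auto
    qed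
    \<comment> \<open>A core reached from outside the component \<open>U\<close> lies wholly outside
      it, so the hypothesis is inherited by the remaining components.\<close>
    have coreq: "X \<in> cores (R - U) (F - FU) \<and> reaches (F - FU) w X \<longleftrightarrow> X \<in> cores R F \<and> reaches F w X"
      if w: "w \<in> V - U" for w X
    proof
      assume "X \<in> cores (R - U) (F - FU) \<and> reaches (F - FU) w X"
      then show "X \<in> cores R F \<and> reaches F w X"
        unfolding cores_def reaches_def
        using cycles_in_mono[of "F - FU" F] joined_mono[of "F - FU" F] by blast
    next
      assume X: "X \<in> cores R F \<and> reaches F w X"
      then obtain y where y: "y \<in> pverts X" "(w, y) \<in> joined F" by (auto simp: reaches_def)
      have wy: "y \<in> - U \<and> (w, y) \<in> joined {e \<in> F. fst e \<in> - U}"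
        by (rule joined_closed[OF y(2)]) (use w cl in auto)
      moreover have "{e \<in> F. fst e \<in> - U} = F - FU" by (auto simp: FU_def)
      ultimately have "reaches (F - FU) w X" "y \<notin> U" using y(1) by (auto simp: reaches_def)
      moreover have "X \<in> cores (R - U) (F - FU)"
      proof (cases "X \<in> cycles_in F")
        case True
        have "z \<notin> U" if "z \<in> pverts X" for z
        proof
          assume "z \<in> U"
          then have "(v, y) \<in> joined F"
            using cycles_in_connected[OF True o that y(1)] by (auto simp: U_def intro: rtrancl_trans)
          then show False using \<open>y \<notin> U\<close> by (simp add: U_def)
        qed
        moreover have "parcs X \<subseteq> pverts X \<times> pverts X"
          using cycles_in_orient[OF True o] by (simp add: oriented_on_def)
        ultimately have "parcs X \<subseteq> F - FU" using True unfolding cycles_in_def FU_def by auto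
        then show ?thesis using True unfolding cycles_in_def cores_def by auto
      next
        case False
        then obtain r where "r \<in> R" "X = \<lparr>pverts = {r}, parcs = {}\<rparr>" using X by (auto simp: cores_def)
        then show ?thesis using y(1) \<open>y \<notin> U\<close> by (auto simp: cores_def)
      qed
      ultimately show "X \<in> cores (R - U) (F - FU) \<and> reaches (F - FU) w X" by simp
    qed
    have "card (F - FU) + card (R - U) \<le> card (V - U)"
    proof (rule less.hyps)
      show "card (V - U) < card V" using fin v vU by (intro psubset_card_mono) auto
      show "one_core (R - U) (V - U) (F - FU)"
        using less.prems(3) coreq unfolding one_core_def by auto
    qed (use oC less.prems(2) in auto)
    moreover have "card FU + card (R \<inter> U) \<le> card U"
    proof -
      obtain X where X: "X \<in> cores R F" and uniq: "\<And>Y. Y \<in> cores R F \<Longrightarrow> reaches F v Y \<Longrightarrow> Y = X"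
        using less.prems(3) v unfolding one_core_def by metis
      have cyc_eq: "C = X" if C: "C \<in> cycles_in FU" for C
      proof -
        obtain u where u: "u \<in> pverts C" using cycles_in_pverts_nonempty[OF C] by auto
        then have "u \<in> U" using cycles_in_pverts_subset[OF C oU] by auto
        then have "reaches F v C" using u by (auto simp: reaches_def U_def)
        moreover have "C \<in> cores R F" using C cycles_in_mono[of FU F] by (auto simp: FU_def cores_def)
        ultimately show ?thesis using uniq by blast
      qed
      have root_eq: "\<lparr>pverts = {r}, parcs = {}\<rparr> = X" if "r \<in> R \<inter> U" for r
        using that uniq by (auto simp: cores_def reaches_def U_def)
      have finU: "finite U" "finite FU" using oriented_on_finite[OF oU] .
      show ?thesis
      proof (cases "X \<in> cycles_in F")
        case True
        have "parcs X \<noteq> {}" by (rule cycles_in_parcs_nonempty[OF True o])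
        then have "R \<inter> U = {}" using root_eq by fastforce
        obtain e where e: "e \<in> parcs X" using \<open>parcs X \<noteq> {}\<close> by auto
        have "oriented_on U (FU - {e})" using oU by (auto simp: oriented_on_def)
        moreover have "cycles_in (FU - {e}) = {}"
        proof (rule ccontr)
          assume "cycles_in (FU - {e}) \<noteq> {}"
          then obtain C where C: "C \<in> cycles_in (FU - {e})" by auto
          then have "C = X" using cyc_eq cycles_in_mono[of "FU - {e}" FU] by auto
          then show False using C e by (auto simp: cycles_in_def)
        qed
        ultimately have "card (FU - {e}) < card U" using vU by (intro forest_card) auto
        moreover have "card FU \<le> Suc (card (FU - {e}))"
          by (cases "e \<in> FU") (simp_all add: card_Diff_singleton)
        ultimately show ?thesis using \<open>R \<inter> U = {}\<close> by simp
      next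
        case False
        then have "cycles_in FU = {}" using cyc_eq cycles_in_mono[of FU F] by (auto simp: FU_def)
        then have "card FU < card U" using vU oU by (intro forest_card) auto
        moreover have "card (R \<inter> U) \<le> 1"
        proof (rule ccontr)
          assume "\<not> card (R \<inter> U) \<le> 1"
          then obtain r s where "r \<in> R \<inter> U" "s \<in> R \<inter> U" "r \<noteq> s"
            using card_le_Suc0_iff_eq[of "R \<inter> U"] finU(1) by auto
          then have "\<lparr>pverts = {r}, parcs = {}\<rparr> = \<lparr>pverts = {s}, parcs = {}\<rparr>" "r \<noteq> s"
            using root_eq by metis+
          then show False by simp
        qed
        ultimately show ?thesis by simp
      qed
    qed
    moreover have "card F = card FU + card (F - FU)" "card R = card (R \<inter> U) + card (R - U)"
      "card V = card U + card (V - U)"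
    proof -
      show "card F = card FU + card (F - FU)"
        using fin card_Diff_subset[of FU F] card_mono[of F FU] finite_subset[of FU F] by (auto simp: FU_def)
      show "card R = card (R \<inter> U) + card (R - U)"
        by (metis Diff_disjoint Int_Diff_Un Int_Diff_disjoint card_Un_disjoint fin(3) finite_Diff finite_Int)
      show "card V = card U + card (V - U)"
        using fin(1) UV card_Diff_subset[of U V] card_mono[of V U] finite_subset[OF UV] by simp
    qed
    ultimately show ?thesis by linarith
  qed
qed

lemma handshake:
  assumes "oriented_on V F"
  shows "(\<Sum>v\<in>V. card (incident F v)) = 2 * card F"
  unfolding incident_def
proof (rule sum_multicount)
  show "\<forall>e\<in>F. card {v \<in> V. fst e = v \<or> snd e = v} = 2"
  proof
    fix e assume e: "e \<in> F"
    have "{v \<in> V. fst e = v \<or> snd e = v} = {fst e, snd e}"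
      using e assms by (cases e) (auto simp: oriented_on_def)
    moreover have "fst e \<noteq> snd e" using e oriented_on_noloop[OF assms] by (cases e) auto
    ultimately show "card {v \<in> V. fst e = v \<or> snd e = v} = 2" by simp
  qed
qed (use oriented_on_finite[OF assms] in auto)

text \<open>The degrees sum to 2|F| \<le> 2(|V| - |R|), and each vertex outside \<open>R\<close>
  contributes at least two. Hence equality holds throughout: roots have degree zero and all others
  degree two, so any cycle is cut off from the remaining arcs.\<close>

lemma peel:
  assumes "oriented_on V F" "R \<subseteq> V" "card F + card R \<le> card V" "\<forall>v\<in>V - R. incident F v \<noteq> {}"
    and no_leaf: "\<forall>v\<in>V - R. \<forall>e. incident F v \<noteq> {e}" and "V \<noteq> R"
  obtains p C where "goes_around p C" "parcs C \<subseteq> F" "pverts C \<subseteq> V - R"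
    "\<forall>e\<in>F. fst e \<in> pverts C \<or> snd e \<in> pverts C \<longrightarrow> e \<in> parcs C"
proof -
  have fin: "finite V" "finite F" "finite R"
    using oriented_on_finite[OF assms(1)] finite_subset[OF assms(2)] by auto
  have ge2: "card (incident F v) \<ge> 2" if v: "v \<in> V - R" for v
  proof -
    have "card (incident F v) \<noteq> 0" using assms(4) v finite_inc[OF fin(2)] by simp
    moreover have "card (incident F v) \<noteq> 1" using no_leaf v by (auto simp: card_1_singleton_iff)
    ultimately show ?thesis by linarith
  qed
  have split: "(\<Sum>v\<in>V. card (incident F v)) = (\<Sum>v\<in>V - R. card (incident F v)) + (\<Sum>v\<in>R. card (incident F v))"
    by (rule sum.subset_diff[OF assms(2) fin(1)])
  have lb: "(\<Sum>v\<in>V - R. 2) \<le> (\<Sum>v\<in>V - R. card (incident F v))" by (intro sum_mono ge2)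
  have cV: "card (V - R) = card V - card R" using fin assms(2) by (simp add: card_Diff_subset)
  have le: "card R \<le> card V" by (rule card_mono[OF fin(1) assms(2)])
  have s0: "(\<Sum>v\<in>R. card (incident F v)) = 0" and s2: "(\<Sum>v\<in>V - R. card (incident F v)) = (\<Sum>v\<in>V - R. 2)"
    using split lb handshake[OF assms(1)] assms(3) cV le by auto
  have R0: "incident F v = {}" if "v \<in> R" for v
    using s0 that fin finite_inc[OF fin(2)] by (simp add: sum_eq_0_iff)
  have V2: "card (incident F v) = 2" if "v \<in> V - R" for v
  proof (rule ccontr)
    assume "card (incident F v) \<noteq> 2"
    then have "2 < card (incident F v)" using ge2[OF that] by simp
    then have "(\<Sum>v\<in>V - R. 2) < (\<Sum>v\<in>V - R. card (incident F v))"
      using fin that ge2 by (intro sum_strict_mono_ex1) auto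
    then show False using s2 by simp
  qed
  have out: "incident F v = {}" if "v \<notin> V" for v
    using that assms(1) by (auto simp: oriented_on_def incident_def)
  obtain x where "x \<in> V - R" using assms(2,6) by blast
  then have "F \<noteq> {}" using V2[of x] by (auto simp: incident_def)
  moreover have "card (incident F v) \<noteq> 1" for v
    using R0[of v] V2[of v] out[of v] by (cases "v \<in> V"; cases "v \<in> R") auto
  ultimately obtain C where C: "C \<in> cycles_in F" using cycle_exists[OF assms(1)] by blast
  then obtain p where p: "goes_around p C" "parcs C \<subseteq> F" by (auto simp: cycles_in_def)
  have CV: "pverts C \<subseteq> V - R"
  proof
    fix v assume v: "v \<in> pverts C"
    have "card (incident (parcs C) v) = 2" by (rule card_inc_cycle[OF p(1) cycles_in_orient[OF C assms(1)] v])
    then have "incident (parcs C) v \<noteq> {}" by auto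
    then have "incident F v \<noteq> {}" using p(2) by (auto simp: incident_def)
    then show "v \<in> V - R" using R0 out by auto
  qed
  have "e \<in> parcs C" if "e \<in> F" "fst e \<in> pverts C \<or> snd e \<in> pverts C" for e
  proof -
    note e = that
    obtain v where "v \<in> pverts C" "fst e = v \<or> snd e = v" using e(2) by blast
    then have v: "v \<in> pverts C" "e \<in> incident F v" using e(1) by (auto simp: incident_def)
    show ?thesis by (rule isolated_cycle[OF p assms(1) v(1) _ v(2)]) (use V2 v CV in auto)
  qed
  then show thesis using that[OF p CV] by blast
qed

text \<open>
  The two instances of \<open>P\<close> are the uniqueness of the core reached and the non-vanishing of a minor.
\<close>

lemma hereditary_imp_pseudoforest:
  assumes P: "\<And>V F. P V F \<Longrightarrow> oriented_on V F \<and> R \<subseteq> V \<and> card F + card R \<le> card V \<and> (\<forall>v\<in>V - R. incident F v \<noteq> {})"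
    and leaf: "\<And>V F v u e. oriented_on V F \<Longrightarrow> R \<subseteq> V \<Longrightarrow> v \<notin> V \<Longrightarrow> u \<in> V \<Longrightarrow> e = (u, v) \<or> e = (v, u) \<Longrightarrow>
      P (insert v V) (insert e F) \<Longrightarrow> P V F"
    and cycle: "\<And>V F p C. oriented_on V F \<Longrightarrow> R \<subseteq> V \<Longrightarrow> goes_around p C \<Longrightarrow> oriented_on (pverts C) (parcs C) \<Longrightarrow>
      pverts C \<inter> V = {} \<Longrightarrow> P (V \<union> pverts C) (F \<union> parcs C) \<Longrightarrow> P V F"
  shows "P V F \<Longrightarrow> pseudoforest R V F"
proof (induction "card V" arbitrary: V F rule: less_induct)
  case less
  note o = P[OF less.prems]
  have fin: "finite V" using o oriented_on_finite by blast
  consider "V = R" | v e where "v \<in> V - R" "incident F v = {e}"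
    | "V \<noteq> R" "\<forall>v\<in>V - R. \<forall>e. incident F v \<noteq> {e}" by blast
  then show ?case
  proof cases
    case 1
    then have "card F = 0" "finite F" using o oriented_on_finite(2)[of V F] by auto
    then have "F = {}" by simp
    then show ?thesis using 1 fin by (simp add: pseudoforest.base)
  next
    case 2
    obtain u where u: "u \<in> V - {v}" "e = (u, v) \<or> e = (v, u)" "oriented_on (V - {v}) (F - {e})" "e \<in> F" "v \<in> V"
      using leaf_split[OF _ 2(2)] o by metis
    have eq: "insert v (V - {v}) = V" "insert e (F - {e}) = F" using u by auto
    have "P (V - {v}) (F - {e})"
      by (rule leaf[OF u(3) _ _ u(1,2)]) (use o 2 less.prems eq in auto)
    moreover have "card (V - {v}) < card V" using fin u by (intro psubset_card_mono) auto
    ultimately have "pseudoforest R (V - {v}) (F - {e})" using less.hyps by blast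
    then have "pseudoforest R (insert v (V - {v})) (insert e (F - {e}))"
      by (rule pseudoforest.leaf[OF _ _ u(1,2)]) simp
    then show ?thesis unfolding eq .
  next
    case 3
    obtain p C where p: "goes_around p C" "parcs C \<subseteq> F" "pverts C \<subseteq> V - R"
      "\<forall>e\<in>F. fst e \<in> pverts C \<or> snd e \<in> pverts C \<longrightarrow> e \<in> parcs C"
      using o 3(2,1) by (elim conjE) (rule peel)
    have C: "C \<in> cycles_in F" using p by (auto simp: cycles_in_def)
    have oC: "oriented_on (pverts C) (parcs C)" using cycles_in_orient[OF C] o by blast
    have eq: "(V - pverts C) \<union> pverts C = V" "(F - parcs C) \<union> parcs C = F" using p by auto
    have "F - parcs C \<subseteq> (V - pverts C) \<times> (V - pverts C)"
    proof
      fix e assume e: "e \<in> F - parcs C"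
      then have "fst e \<notin> pverts C" "snd e \<notin> pverts C" using p(4) by auto
      then show "e \<in> (V - pverts C) \<times> (V - pverts C)"
        using e o by (cases e) (auto simp: oriented_on_def)
    qed
    then have o': "oriented_on (V - pverts C) (F - parcs C)" using o unfolding oriented_on_def by auto
    have "P (V - pverts C) (F - parcs C)"
      by (rule cycle[OF o' _ p(1) oC]) (use p o less.prems eq in auto)
    moreover have "card (V - pverts C) < card V"
      using fin p(3) cycles_in_pverts_nonempty[OF C] by (intro psubset_card_mono) auto
    ultimately have "pseudoforest R (V - pverts C) (F - parcs C)" using less.hyps by blast
    then have "pseudoforest R ((V - pverts C) \<union> pverts C) ((F - parcs C) \<union> parcs C)"
      by (rule pseudoforest.cycle[OF _ p(1) oC]) auto
    then show ?thesis unfolding eq .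
  qed
qed

lemma one_core_imp_pseudoforest:
  assumes "oriented_on V F" "R \<subseteq> V" "one_core R V F"
  shows "pseudoforest R V F"
proof (rule hereditary_imp_pseudoforest[of "\<lambda>V F. oriented_on V F \<and> R \<subseteq> V \<and> one_core R V F"])
  fix V F assume P: "oriented_on V F \<and> R \<subseteq> V \<and> one_core R V F"
  \<comment> \<open>An isolated vertex reaches only itself, so it lies on its core. Not being a
    root, it would be on a cycle and have degree two.\<close>
  have "incident F v \<noteq> {}" if v: "v \<in> V - R" for v
  proof
    assume e: "incident F v = {}"
    obtain X u where X: "X \<in> cores R F" "u \<in> pverts X" "(v, u) \<in> joined F"
      using P v unfolding one_core_def reaches_def by blast
    have "u \<in> {v}"
      by (rule joined_closed[OF X(3), THEN conjunct1]) (use e in \<open>auto simp: incident_def\<close>)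
    then have vX: "v \<in> pverts X" using X(2) by simp
    then have "X \<in> cycles_in F" using X(1) v by (auto simp: cores_def)
    then obtain p where p: "goes_around p X" "parcs X \<subseteq> F" by (auto simp: cycles_in_def)
    have "card (incident (parcs X) v) = 2"
      using card_inc_cycle[OF p(1) cycles_in_orient[OF \<open>X \<in> cycles_in F\<close>] vX] P by blast
    moreover have "incident (parcs X) v = {}" using e p(2) by (auto simp: incident_def)
    ultimately show False by simp
  qed
  then show "oriented_on V F \<and> R \<subseteq> V \<and> card F + card R \<le> card V \<and> (\<forall>v\<in>V - R. incident F v \<noteq> {})"
    using P one_core_card by blast
next
  fix V F v u e
  assume "oriented_on V F" "R \<subseteq> V" "v \<notin> V" "u \<in> V" "e = (u, v) \<or> e = (v, u)"
    "oriented_on (insert v V) (insert e F) \<and> R \<subseteq> insert v V \<and> one_core R (insert v V) (insert e F)"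
  then show "oriented_on V F \<and> R \<subseteq> V \<and> one_core R V F"
    using pendant_one_core[of V F v u e R] by simp
next
  fix V F p C
  assume "oriented_on V F" "R \<subseteq> V" "goes_around p C" "oriented_on (pverts C) (parcs C)" "pverts C \<inter> V = {}"
    "oriented_on (V \<union> pverts C) (F \<union> parcs C) \<and> R \<subseteq> V \<union> pverts C \<and>
      one_core R (V \<union> pverts C) (F \<union> parcs C)"
  then show "oriented_on V F \<and> R \<subseteq> V \<and> one_core R V F"
    using disjoint_one_core[of V F p C R] by simp
qed (use assms in simp)

text \<open>A pendant vertex brings one arc and a cycle as many arcs as vertices, so only the roots
  are unmatched. This is why the minor with rows \<open>V - R\<close> and columns \<open>F\<close>
  is square.\<close>

lemma pseudoforest_card:
  assumes "pseudoforest R V F"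
  shows "card F + card R = card V"
  using assms
proof (induction rule: pseudoforest.induct)
  case (leaf V F v u e)
  have o: "oriented_on V F" using pseudoforest_orient[OF leaf.hyps(1)] by simp
  show ?case using leaf pendant_inc(2)[OF o leaf.hyps(2-4)] oriented_on_finite[OF o] by simp
next
  case (cycle V F p C)
  have o: "oriented_on V F" using pseudoforest_orient[OF cycle.hyps(1)] by simp
  obtain k ed where "pverts C = (!) p ` {..<k}" "inj_on ((!) p) {..<k}"
    "parcs C = ed ` {..<k}" "inj_on ed {..<k}"
    using goes_around_index[OF cycle.hyps(2,3)] by metis
  then have "card (pverts C) = card (parcs C)" by (simp add: card_image)
  moreover have "F \<inter> parcs C = {}" using o cycle.hyps(3,4) by (auto simp: oriented_on_def)
  moreover have "finite (pverts C)" "finite (parcs C)" using oriented_on_finite[OF cycle.hyps(3)] .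
  ultimately show ?case
    using cycle.IH cycle.hyps(4) oriented_on_finite[OF o] by (simp add: card_Un_disjoint Int_commute)
qed simp

text \<open>While \<open>V'\<close> is not all of \<open>V\<close>, connectedness provides an arc of
  \<open>E\<close> across its boundary, and attaching it as a pendant arc creates no cycle. Grown
  from a root this gives a spanning tree, grown from a cycle a connected unicyclic spanning
  subgraph.\<close>

lemma pseudoforest_extend:
  assumes "oriented_on V E" "\<And>x y. x \<in> V \<Longrightarrow> y \<in> V \<Longrightarrow> (x, y) \<in> joined E"
    and "pseudoforest R V' F'" "F' \<subseteq> E" "V' \<subseteq> V" "V' \<noteq> {}"
  shows "\<exists>F. pseudoforest R V F \<and> F \<subseteq> E \<and> cycles_in F = cycles_in F'"
  using assms(3-6)
proof (induction "card (V - V')" arbitrary: V' F' rule: less_induct)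
  case less
  show ?case
  proof (cases "V' = V")
    case True
    then show ?thesis using less.prems by blast
  next
    case False
    then obtain y where y: "y \<in> V" "y \<notin> V'" using less.prems by auto
    obtain x where x: "x \<in> V'" using less.prems by auto
    have "(x, y) \<in> joined E" using x y less.prems assms(2) by auto
    then have "\<not> (\<forall>a b. (a, b) \<in> E \<longrightarrow> (a \<in> V' \<longleftrightarrow> b \<in> V'))"
      using joined_closed[of x y E V'] x y by blast
    then obtain u v e where e: "e \<in> E" "e = (u, v) \<or> e = (v, u)" "u \<in> V'" "v \<notin> V'" by blast
    have v: "v \<in> V" using e assms(1) by (auto simp: oriented_on_def)
    have o: "oriented_on V' F'" using pseudoforest_orient[OF less.prems(1)] by simp
    have "\<exists>F. pseudoforest R V F \<and> F \<subseteq> E \<and> cycles_in F = cycles_in (insert e F')"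
    proof (rule less.hyps)
      show "card (V - insert v V') < card (V - V')"
        using v e oriented_on_finite[OF assms(1)] by (intro psubset_card_mono) auto
      show "pseudoforest R (insert v V') (insert e F')" by (rule pseudoforest.leaf[OF less.prems(1) e(4,3,2)])
    qed (use less.prems e v in auto)
    then show ?thesis unfolding pendant_cycles_in[OF o e(4,3,2)] .
  qed
qed


section \<open>Minors of the incidence matrix\<close>

text \<open>Indexing by lists of vertices and arcs allows rows and columns to be reordered and split
  into blocks without arithmetic on positions.\<close>

definition list_mat :: "('a \<Rightarrow> 'b \<Rightarrow> 'c) \<Rightarrow> 'a list \<Rightarrow> 'b list \<Rightarrow> 'c mat" where
  "list_mat f xs ys = mat (length xs) (length ys) (\<lambda>(i, j). f (xs ! i) (ys ! j))"

lemma transpose_list_mat: "transpose_mat (list_mat f xs ys) = list_mat (\<lambda>y x. f x y) ys xs"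
  by (rule eq_matI) (auto simp: list_mat_def)

lemma cmod_det_permute_rows:
  fixes f :: "'a \<Rightarrow> 'b \<Rightarrow> complex"
  assumes "mset xs = mset xs'" "length xs' = length ys"
  shows "cmod (det (list_mat f xs ys)) = cmod (det (list_mat f xs' ys))"
proof -
  define n where "n = length xs'"
  obtain p where p: "p permutes {..<n}" "permute_list p xs' = xs"
    using mset_eq_permutation[OF assms(1)] unfolding n_def by blast
  have xs: "length xs = n" "\<And>i. i < n \<Longrightarrow> xs ! i = xs' ! p i" "\<And>i. i < n \<Longrightarrow> p i < n"
    using p permute_list_nth[of p xs'] permutes_in_image[OF p(1)] by (auto simp: n_def)
  have "list_mat f xs ys = mat n n (\<lambda>(i, j). list_mat f xs' ys $$ (p i, j))"
    using xs assms(2) by (intro eq_matI) (auto simp: list_mat_def n_def)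
  moreover have "list_mat f xs' ys \<in> carrier_mat n n" using assms(2) by (simp add: list_mat_def n_def)
  ultimately have "det (list_mat f xs ys) = signof p * det (list_mat f xs' ys)"
    using det_permute_rows[of _ n p] p(1) by (simp add: atLeast0LessThan)
  moreover have "cmod (signof p) = 1" by (cases p rule: sign_cases) simp_all
  ultimately show ?thesis by (simp add: norm_mult)
qed

text \<open>Reordering rows or columns changes a determinant by a sign only, so its modulus depends
  on the two sets. Both sides have the same shape, and a non-square matrix has determinant 0 by
  convention.\<close>

lemma cmod_det_list_mat_cong:
  fixes f :: "'a \<Rightarrow> 'b \<Rightarrow> complex"
  assumes "distinct xs" "distinct xs'" "set xs = set xs'"
    and "distinct ys" "distinct ys'" "set ys = set ys'"
  shows "cmod (det (list_mat f xs ys)) = cmod (det (list_mat f xs' ys'))"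
proof (cases "length xs = length ys")
  case True
  have m: "mset xs = mset xs'" "mset ys = mset ys'"
    using assms set_eq_iff_mset_eq_distinct by blast+
  have l: "length xs' = length ys" "length xs' = length ys'"
    using True mset_eq_length[OF m(1)] mset_eq_length[OF m(2)] by simp_all
  have tr: "det (list_mat (\<lambda>y x. f x y) zs xs') = det (list_mat f xs' zs)" if "length zs = length xs'" for zs
    unfolding transpose_list_mat[of f xs' zs, symmetric]
    by (rule det_transpose[of _ "length xs'"]) (simp add: list_mat_def that)
  have "cmod (det (list_mat f xs ys)) = cmod (det (list_mat f xs' ys))"
    by (rule cmod_det_permute_rows[OF m(1) l(1)])
  also have "\<dots> = cmod (det (list_mat f xs' ys'))"
    using cmod_det_permute_rows[OF m(2), of xs' "\<lambda>y x. f x y"] tr[of ys] tr[of ys'] l by simp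
  finally show ?thesis .
next
  case False
  moreover have "length xs' = length xs" "length ys' = length ys"
    using assms by (metis distinct_card)+
  ultimately show ?thesis by (simp add: list_mat_def det_def)
qed

lemma det_list_mat_append:
  fixes f :: "'a \<Rightarrow> 'b \<Rightarrow> complex"
  assumes "length xs = length ys" "length xs' = length ys'"
    and "\<And>x y. x \<in> set xs \<Longrightarrow> y \<in> set ys' \<Longrightarrow> f x y = 0"
  shows "det (list_mat f (xs @ xs') (ys @ ys')) = det (list_mat f xs ys) * det (list_mat f xs' ys')"
proof -
  have "list_mat f (xs @ xs') (ys @ ys') = four_block_mat (list_mat f xs ys)
      (0\<^sub>m (length xs) (length xs')) (list_mat f xs' ys) (list_mat f xs' ys')"
    using assms by (intro eq_matI) (auto simp: list_mat_def nth_append)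
  also have "det \<dots> = det (list_mat f xs ys) * det (list_mat f xs' ys')"
    by (rule det_four_block_mat_upper_right_zero) (use assms in \<open>auto simp: list_mat_def\<close>)
  finally show ?thesis .
qed

lemma det_list_mat_zero_row:
  fixes f :: "'a \<Rightarrow> 'b \<Rightarrow> complex"
  assumes "x \<in> set xs" "\<And>y. y \<in> set ys \<Longrightarrow> f x y = 0"
  shows "det (list_mat f xs ys) = 0"
proof (cases "length xs = length ys")
  case True
  obtain i where i: "i < length xs" "xs ! i = x" using assms(1) by (auto simp: in_set_conv_nth)
  have "list_mat f xs ys \<in> carrier_mat (length xs) (length xs)" using True by (simp add: list_mat_def)
  from laplace_expansion_row[OF this i(1)] show ?thesis
    using i True assms(2) by (simp add: list_mat_def)
next
  case False
  then show ?thesis by (simp add: list_mat_def det_def)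
qed

text \<open>Row 0 has entries only in columns 0 and \<open>m\<close>, which differ as
  \<open>m \<ge> 1\<close>. Deleting column 0 leaves a lower triangular matrix with diagonal from
  \<open>a\<close>, deleting column \<open>m\<close> an upper triangular one with diagonal from
  \<open>b\<close>; the sign is that of the cofactor at (0, m).\<close>

lemma det_cyclic:
  fixes a b :: "nat \<Rightarrow> complex"
  assumes "m \<ge> 1"
  shows "det (mat (Suc m) (Suc m) (\<lambda>(i, j). if i = j then a j
      else if i = Suc j \<or> (i = 0 \<and> j = m) then b j else 0)) =
    (\<Prod>i\<le>m. a i) + (-1) ^ m * (\<Prod>i\<le>m. b i)"
proof -
  define A where "A = mat (Suc m) (Suc m) (\<lambda>(i, j). if i = j then a j
      else if i = Suc j \<or> (i = 0 \<and> j = m) then b j else 0)"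
  have A: "A \<in> carrier_mat (Suc m) (Suc m)" by (simp add: A_def)
  have "det A = (\<Sum>j<Suc m. A $$ (0, j) * cofactor A 0 j)"
    by (rule laplace_expansion_row[OF A]) simp
  also have "\<dots> = (\<Sum>j\<in>{0, m}. A $$ (0, j) * cofactor A 0 j)"
    by (rule sum.mono_neutral_right) (auto simp: A_def)
  also have "\<dots> = a 0 * cofactor A 0 0 + b m * cofactor A 0 m"
    using assms by (simp add: A_def)
  also have "cofactor A 0 0 = (\<Prod>i<m. a (Suc i))"
  proof -
    have "det (mat_delete A 0 0) = prod_list (diag_mat (mat_delete A 0 0))"
      by (rule det_lower_triangular[of m]) (use A in \<open>auto simp: mat_delete_def A_def\<close>)
    also have "\<dots> = (\<Prod>i\<in>{0..<m}. a (Suc i))"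
      unfolding prod_list_diag_prod by (rule prod.cong) (auto simp: mat_delete_def A_def)
    finally show ?thesis by (simp add: cofactor_def atLeast0LessThan)
  qed
  also have "cofactor A 0 m = (-1) ^ m * (\<Prod>i<m. b i)"
  proof -
    have "det (mat_delete A 0 m) = prod_list (diag_mat (mat_delete A 0 m))"
      by (rule det_upper_triangular[of _ m]) (use A in \<open>auto simp: mat_delete_def A_def\<close>)
    also have "\<dots> = (\<Prod>i\<in>{0..<m}. b i)"
      unfolding prod_list_diag_prod by (rule prod.cong) (auto simp: mat_delete_def A_def)
    finally show ?thesis by (simp add: cofactor_def atLeast0LessThan)
  qed
  also have "a 0 * (\<Prod>i<m. a (Suc i)) = (\<Prod>i\<le>m. a i)"
    by (metis lessThan_Suc_atMost prod.lessThan_Suc_shift)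
  also have "b m * ((-1) ^ m * (\<Prod>i<m. b i)) = (-1) ^ m * (\<Prod>i\<le>m. b i)"
    by (simp add: lessThan_Suc_atMost[symmetric])
  finally show ?thesis unfolding A_def .
qed

section \<open>Minors of cycles and of pseudoforests\<close>

definition incidence_entry :: "('a \<times> 'a \<Rightarrow> complex) \<Rightarrow> 'a \<Rightarrow> 'a \<times> 'a \<Rightarrow> complex" where
  "incidence_entry w v e = (if v = fst e then csqrt (w e) else if v = snd e then csqrt (cnj (w e)) else 0)"

text \<open>Conjugation respects the half-plane of principal roots unless the root lies on the
  positive imaginary axis, and then \<open>z\<close> is a negative real. This is where the
  restriction on the weights enters.\<close>

lemma csqrt_cnj:
  assumes "z \<notin> neg_reals"
  shows "csqrt (cnj z) = cnj (csqrt z)"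
proof (rule csqrt_unique)
  show "(cnj (csqrt z))\<^sup>2 = cnj z" by (metis complex_cnj_power power2_csqrt)
  show "0 < Re (cnj (csqrt z)) \<or> Re (cnj (csqrt z)) = 0 \<and> 0 \<le> Im (cnj (csqrt z))"
  proof (cases "Re (csqrt z) = 0")
    case True
    define t where "t = Im (csqrt z)"
    have "csqrt z = \<i> * of_real t" using True by (auto simp: complex_eq_iff t_def)
    then have z: "z = - (of_real t)\<^sup>2" by (metis power2_csqrt power_mult_distrib power2_i mult_minus1)
    have "t = 0"
    proof (rule ccontr)
      assume "t \<noteq> 0"
      then have "z = complex_of_real (- t\<^sup>2)" "- t\<^sup>2 < 0" using z by auto
      then show False using assms unfolding neg_reals_def by blast
    qed
    then have "csqrt z = 0" using True by (simp only: complex_eq_iff t_def zero_complex.sel)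
    then show ?thesis by simp
  next
    case False
    then show ?thesis using csqrt_principal[of z] by auto
  qed
qed

lemma cmod_incidence_entry: "v = fst e \<or> v = snd e \<Longrightarrow> (cmod (incidence_entry w v e))\<^sup>2 = cmod (w e)"
  by (auto simp: incidence_entry_def)

text \<open>In cyclic order the matrix is that of \<open>det_cyclic\<close> with conjugate entries
  \<open>a i\<close> and \<open>b i\<close>, so the determinant is A \<plusminus> cnj A with A^2 the
  weight of the cycle. The exponent \<open>m\<close> of the sign is the length minus one, so even
  cycles receive the minus sign.\<close>

lemma det_cycle:
  assumes G: "oriented_on V (parcs G)" "\<And>e. e \<in> parcs G \<Longrightarrow> w e \<notin> neg_reals"
    and C: "goes_around p C" "parcs C \<subseteq> parcs G"
    and xs: "distinct xs" "set xs = pverts C" and ys: "distinct ys" "set ys = parcs C"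
  shows "(cmod (det (list_mat (incidence_entry w) xs ys)))\<^sup>2 = 2 * cycle_alpha G w C"
    and "length xs = length ys"
proof -
  \<comment> \<open>This is the very traversal used by \<open>cycle_weight\<close>, so the weight
    can be computed along the same cyclic coordinates as the determinant.\<close>
  define q where "q = (SOME p. goes_around p C)"
  have q: "goes_around q C" using C(1) unfolding q_def by (rule someI)
  have oC: "oriented_on V (parcs C)" using G(1) C(2) unfolding oriented_on_def by blast
  obtain k ed where k: "k \<ge> 3" "length q = Suc k" and wrap: "q ! k = q ! 0"
    and inj: "inj_on ((!) q) {..<k}" and vs: "pverts C = (!) q ` {..<k}"
    and ed': "\<forall>i<k. ed i = (q ! i, q ! Suc i) \<or> ed i = (q ! Suc i, q ! i)"
    and pc: "parcs C = ed ` {..<k}" and injed: "inj_on ed {..<k}"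
    by (rule goes_around_index[OF q oC])
  have ed: "ed i = (q ! i, q ! Suc i) \<or> ed i = (q ! Suc i, q ! i)" if "i < k" for i
    using ed' that by blast
  have edG: "ed i \<in> parcs G" if "i < k" for i using pc C(2) that by auto
  define a where "a = (\<lambda>i. incidence_entry w (q ! i) (ed i))"
  define b where "b = (\<lambda>i. incidence_entry w (q ! Suc i) (ed i))"
  have neq: "q ! i \<noteq> q ! Suc i" if "i < k" for i
  proof
    assume "q ! i = q ! Suc i"
    then have "ed i = (q ! i, q ! i)" using ed[OF that] by simp
    then show False using edG[OF that] oriented_on_noloop[OF G(1)] by simp
  qed
  have ba: "b i = cnj (a i)" if "i < k" for i
  proof -
    have c: "csqrt (cnj (w (ed i))) = cnj (csqrt (w (ed i)))" by (rule csqrt_cnj[OF G(2)[OF edG[OF that]]])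
    from ed[OF that] show ?thesis
    proof
      assume e: "ed i = (q ! i, q ! Suc i)"
      then have "a i = csqrt (w (ed i))" "b i = csqrt (cnj (w (ed i)))"
        unfolding a_def b_def incidence_entry_def using neq[OF that] by simp_all
      then show ?thesis using c by simp
    next
      assume e: "ed i = (q ! Suc i, q ! i)"
      then have "a i = csqrt (cnj (w (ed i)))" "b i = csqrt (w (ed i))"
        unfolding a_def b_def incidence_entry_def using neq[OF that] by simp_all
      then show ?thesis using c by simp
    qed
  qed
  \<comment> \<open>The entry at the start of a step is the root of \<open>w\<close> or of its
    conjugate according to the direction of the arc, in step with the cases of
    \<open>adj_weight\<close>.\<close>
  have adj: "adj_weight G w (q ! i) (q ! Suc i) = (a i)\<^sup>2" if "i < k" for i
  proof -
    have "(y, x) \<notin> parcs G" if "(x, y) \<in> parcs G" for x y using that G(1) by (auto simp: oriented_on_def)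
    then show ?thesis using ed[OF that] edG[OF that] neq[OF that]
      unfolding a_def incidence_entry_def adj_weight_def by (elim disjE) simp_all
  qed
  define A where "A = (\<Prod>i<k. a i)"
  have wt: "cycle_weight G w C = A\<^sup>2"
    using adj k(2) by (simp add: cycle_weight_def walk_weight_def q_def[symmetric] A_def prod_power_distrib)
  have B: "(\<Prod>i<k. b i) = cnj A" using ba by (simp add: A_def)
  define xs' where "xs' = map ((!) q) [0..<k]"
  define ys' where "ys' = map ed [0..<k]"
  have x': "distinct xs'" "set xs' = set xs"
    using inj vs xs(2) by (auto simp: xs'_def distinct_map atLeast0LessThan)
  have y': "distinct ys'" "set ys' = set ys"
    using injed pc ys(2) by (auto simp: ys'_def distinct_map atLeast0LessThan)
  obtain m where m: "k = Suc m" "m \<ge> 1" using k(1) by (cases k) auto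
  have "list_mat (incidence_entry w) xs' ys' = mat (Suc m) (Suc m) (\<lambda>(i, j). if i = j then a j
      else if i = Suc j \<or> (i = 0 \<and> j = m) then b j else 0)"
  proof (rule eq_matI)
    fix i j
    assume "i < dim_row (mat (Suc m) (Suc m) (\<lambda>(i, j). if i = j then a j
      else if i = Suc j \<or> (i = 0 \<and> j = m) then b j else 0))"
      "j < dim_col (mat (Suc m) (Suc m) (\<lambda>(i, j). if i = j then a j
      else if i = Suc j \<or> (i = 0 \<and> j = m) then b j else 0))"
    then have ij: "i < k" "j < k" using m by auto
    have "list_mat (incidence_entry w) xs' ys' $$ (i, j) = incidence_entry w (q ! i) (ed j)"
      using ij by (simp add: list_mat_def xs'_def ys'_def)
    also have "\<dots> = (if i = j then a j else if i = Suc j \<or> (i = 0 \<and> j = m) then b j else 0)"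
    proof -
      have qq: "q ! x = q ! y \<longleftrightarrow> x = y" if "x < k" "y < k" for x y
        using inj_on_eq_iff[OF inj] that by simp
      have S: "q ! i = q ! Suc j \<longleftrightarrow> i = Suc j \<or> (i = 0 \<and> j = m)"
      proof (cases "j = m")
        case True
        then have "q ! Suc j = q ! 0" using wrap m(1) by simp
        then show ?thesis using qq[of i 0] ij True m(1) by simp
      next
        case False
        then have "Suc j < k" using ij m(1) by simp
        then show ?thesis using qq[of i "Suc j"] ij False by simp
      qed
      consider "i = j" | "i \<noteq> j" "i = Suc j \<or> (i = 0 \<and> j = m)"
        | "i \<noteq> j" "\<not> (i = Suc j \<or> (i = 0 \<and> j = m))" by blast
      then show ?thesis
      proof cases
        case 1
        then show ?thesis by (simp add: a_def)
      next
        case 2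
        have "incidence_entry w (q ! i) (ed j) = b j" unfolding b_def using S 2(2) by simp
        then show ?thesis using 2 by (simp only: if_False if_True)
      next
        case 3
        then have "q ! i \<noteq> q ! j" "q ! i \<noteq> q ! Suc j" using S qq[OF ij] by blast+
        then have "incidence_entry w (q ! i) (ed j) = 0" using ed[OF ij(2)] by (auto simp: incidence_entry_def)
        then show ?thesis using 3 by (simp only: if_False)
      qed
    qed
    finally show "list_mat (incidence_entry w) xs' ys' $$ (i, j) = mat (Suc m) (Suc m) (\<lambda>(i, j). if i = j then a j
      else if i = Suc j \<or> (i = 0 \<and> j = m) then b j else 0) $$ (i, j)"
      using ij m by simp
  qed (simp_all add: list_mat_def xs'_def ys'_def m)
  then have "det (list_mat (incidence_entry w) xs' ys') = A + (-1) ^ m * cnj A"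
    using det_cyclic[OF m(2), of a b] B by (simp add: A_def m lessThan_Suc_atMost)
  moreover have "cmod (det (list_mat (incidence_entry w) xs ys)) = cmod (det (list_mat (incidence_entry w) xs' ys'))"
    using xs ys x' y' by (intro cmod_det_list_mat_cong) auto
  moreover have "card (parcs C) = Suc m" using pc injed m by (simp add: card_image)
  \<comment> \<open>For A = x + iy the sum and difference with the conjugate are 2x and 2iy, while
    |A^2| and Re(A^2) are x^2 + y^2 and x^2 - y^2.\<close>
  moreover have "(cmod (A + (-1) ^ m * cnj A))\<^sup>2 = 2 * (cmod (A\<^sup>2) + (-1) ^ m * Re (A\<^sup>2))"
  proof -
    have "cmod (A\<^sup>2) = (Re A)\<^sup>2 + (Im A)\<^sup>2" by (simp add: norm_power cmod_power2)
    moreover have "Re (A\<^sup>2) = (Re A)\<^sup>2 - (Im A)\<^sup>2" by (simp add: power2_eq_square)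
    moreover have "(cmod (A + cnj A))\<^sup>2 = 4 * (Re A)\<^sup>2" "(cmod (A - cnj A))\<^sup>2 = 4 * (Im A)\<^sup>2"
      unfolding complex_add_cnj complex_diff_cnj
      by (simp_all add: norm_mult power_mult_distrib)
    ultimately show ?thesis by (cases "even m") simp_all
  qed
  ultimately show "(cmod (det (list_mat (incidence_entry w) xs ys)))\<^sup>2 = 2 * cycle_alpha G w C"
    unfolding cycle_alpha_def wt by (cases "even m") simp_all
  have "length xs = card (pverts C)" "length ys = card (parcs C)"
    using distinct_card[OF xs(1)] distinct_card[OF ys(1)] xs(2) ys(2) by simp_all
  then show "length xs = length ys" using pc vs inj injed by (simp add: card_image)
qed

text \<open>Row \<open>v\<close> vanishes outside column \<open>e\<close>, so a one-by-one block
  splits off; the arc count makes the remaining block square.\<close>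

lemma det_pendant:
  assumes o: "oriented_on V F" "v \<notin> V" "u \<in> V" "e = (u, v) \<or> e = (v, u)" "R \<subseteq> V"
    and xs: "distinct xs" "set xs = insert v V - R" and ys: "distinct ys" "set ys = insert e F"
    and xs': "distinct xs'" "set xs' = V - R" and ys': "distinct ys'" "set ys' = F"
    and card: "card F + card R = card V"
  shows "cmod (det (list_mat (incidence_entry w) xs ys)) = cmod (incidence_entry w v e) * cmod (det (list_mat (incidence_entry w) xs' ys'))"
proof -
  have fin: "finite V" "finite F" "finite R"
    using oriented_on_finite[OF o(1)] finite_subset[OF o(5)] by auto
  have l: "length xs' = length ys'"
    using distinct_card[OF xs'(1)] distinct_card[OF ys'(1)] xs'(2) ys'(2) card o(5) fin
    by (simp add: card_Diff_subset)
  have eF: "e \<notin> F" by (rule pendant_inc(2)[OF o(1-4)])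
  have "cmod (det (list_mat (incidence_entry w) xs ys)) = cmod (det (list_mat (incidence_entry w) ([v] @ xs') ([e] @ ys')))"
    by (rule cmod_det_list_mat_cong) (use xs ys xs' ys' o eF in auto)
  also have "det (list_mat (incidence_entry w) ([v] @ xs') ([e] @ ys')) =
      det (list_mat (incidence_entry w) [v] [e]) * det (list_mat (incidence_entry w) xs' ys')"
  proof (rule det_list_mat_append)
    fix x y assume "x \<in> set [v]" "y \<in> set ys'"
    then have "x = v" "fst y \<in> V" "snd y \<in> V" using ys'(2) o(1) by (auto simp: oriented_on_def)
    then show "incidence_entry w x y = 0" using o(2) by (auto simp: incidence_entry_def)
  qed (use l in auto)
  also have "det (list_mat (incidence_entry w) [v] [e]) = incidence_entry w v e"
    by (subst det_single) (auto simp: list_mat_def)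
  finally show ?thesis by (simp add: norm_mult)
qed

text \<open>Arcs of \<open>F\<close> have no entries in the rows of \<open>C\<close>, so the matrix
  is block triangular with the cycle as one diagonal block.\<close>

lemma det_disjoint_cycle:
  assumes G: "oriented_on V' (parcs G)" "\<And>e. e \<in> parcs G \<Longrightarrow> w e \<notin> neg_reals"
    and o: "oriented_on V F" "goes_around p C" "oriented_on (pverts C) (parcs C)" "pverts C \<inter> V = {}" "R \<subseteq> V"
      "parcs C \<subseteq> parcs G"
    and xs: "distinct xs" "set xs = (V \<union> pverts C) - R" and ys: "distinct ys" "set ys = F \<union> parcs C"
    and xs': "distinct xs'" "set xs' = V - R" and ys': "distinct ys'" "set ys' = F"
    and card: "card F + card R = card V"
  shows "(cmod (det (list_mat (incidence_entry w) xs ys)))\<^sup>2 =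
    2 * cycle_alpha G w C * (cmod (det (list_mat (incidence_entry w) xs' ys')))\<^sup>2"
proof -
  have fin: "finite V" "finite F" "finite R" "finite (pverts C)" "finite (parcs C)"
    using oriented_on_finite[OF o(1)] oriented_on_finite[OF o(3)] finite_subset[OF o(5)] by auto
  have l: "length xs' = length ys'"
    using distinct_card[OF xs'(1)] distinct_card[OF ys'(1)] xs'(2) ys'(2) card o(5) fin
    by (simp add: card_Diff_subset)
  have FC: "F \<inter> parcs C = {}" using o by (auto simp: oriented_on_def)
  obtain cx where cx: "distinct cx" "set cx = pverts C" using finite_distinct_list[OF fin(4)] by blast
  obtain cy where cy: "distinct cy" "set cy = parcs C" using finite_distinct_list[OF fin(5)] by blast
  note cyc = det_cycle[OF G o(2,6) cx cy]
  have "cmod (det (list_mat (incidence_entry w) xs ys)) = cmod (det (list_mat (incidence_entry w) (cx @ xs') (cy @ ys')))"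
    by (rule cmod_det_list_mat_cong) (use xs ys xs' ys' cx cy o FC in auto)
  also have "det (list_mat (incidence_entry w) (cx @ xs') (cy @ ys')) =
      det (list_mat (incidence_entry w) cx cy) * det (list_mat (incidence_entry w) xs' ys')"
  proof (rule det_list_mat_append)
    fix x y assume "x \<in> set cx" "y \<in> set ys'"
    then have "x \<notin> V" "fst y \<in> V" "snd y \<in> V" using ys'(2) cx o(1,4) by (auto simp: oriented_on_def)
    then show "incidence_entry w x y = 0" by (auto simp: incidence_entry_def)
  qed (use l cyc in auto)
  finally show ?thesis using cyc(1) by (simp add: norm_mult power_mult_distrib)
qed

text \<open>The closed form of the squared modulus of a minor. It depends on the arcs but not on the
  choice of roots, which is what later makes the sums for different single roots equal.\<close>

definition pseudoforest_weight :: "'a pair_pre_digraph \<Rightarrow> ('a \<times> 'a \<Rightarrow> complex) \<Rightarrow> 'a rel \<Rightarrow> real" where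
  "pseudoforest_weight G w F = (\<Prod>e\<in>F - (\<Union>C\<in>cycles_in F. parcs C). cmod (w e)) * (\<Prod>C\<in>cycles_in F. 2 * cycle_alpha G w C)"

lemma pseudoforest_weight_pendant:
  assumes "oriented_on V F" "v \<notin> V" "u \<in> V" "e = (u, v) \<or> e = (v, u)"
  shows "pseudoforest_weight G w (insert e F) = cmod (w e) * pseudoforest_weight G w F"
proof -
  have "e \<notin> F" by (rule pendant_inc(2)[OF assms])
  moreover have "(\<Union>C\<in>cycles_in F. parcs C) \<subseteq> F" by (auto simp: cycles_in_def)
  ultimately have "insert e F - (\<Union>C\<in>cycles_in F. parcs C) = insert e (F - (\<Union>C\<in>cycles_in F. parcs C))"
    "e \<notin> F - (\<Union>C\<in>cycles_in F. parcs C)" by auto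
  then show ?thesis unfolding pseudoforest_weight_def pendant_cycles_in[OF assms]
    using oriented_on_finite[OF assms(1)] by simp
qed

lemma pseudoforest_weight_disjoint_cycle:
  assumes "oriented_on V F" "goes_around p C" "oriented_on (pverts C) (parcs C)" "pverts C \<inter> V = {}"
  shows "pseudoforest_weight G w (F \<union> parcs C) = 2 * cycle_alpha G w C * pseudoforest_weight G w F"
proof -
  have "F \<inter> parcs C = {}" using assms(1,3,4) by (auto simp: oriented_on_def)
  then have "(F \<union> parcs C) - (\<Union>C'\<in>insert C (cycles_in F). parcs C') = F - (\<Union>C\<in>cycles_in F. parcs C)"
    by auto
  then show ?thesis unfolding pseudoforest_weight_def disjoint_cycles_in(1)[OF assms]
    using disjoint_cycles_in(2)[OF assms] finite_cycles_in[OF assms(1)] by simp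
qed

lemma pseudoforest_det:
  assumes "oriented_on V' (parcs G)" "\<And>e. e \<in> parcs G \<Longrightarrow> w e \<notin> neg_reals"
    and "pseudoforest R V F" "F \<subseteq> parcs G"
    and "distinct xs" "set xs = V - R" "distinct ys" "set ys = F"
  shows "(cmod (det (list_mat (incidence_entry w) xs ys)))\<^sup>2 = pseudoforest_weight G w F"
  using assms(3-)
proof (induction arbitrary: xs ys rule: pseudoforest.induct)
  case base
  then show ?case by (simp add: pseudoforest_weight_def list_mat_def det_dim_zero cycles_in_empty)
next
  case (leaf V F v u e)
  have o: "oriented_on V F" "R \<subseteq> V" using pseudoforest_orient[OF leaf.hyps(1)] by auto
  have fin: "finite (V - R)" "finite F" using oriented_on_finite[OF o(1)] by auto
  obtain xs' where xs': "distinct xs'" "set xs' = V - R" using finite_distinct_list[OF fin(1)] by blast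
  obtain ys' where ys': "distinct ys'" "set ys' = F" using finite_distinct_list[OF fin(2)] by blast
  have "(cmod (det (list_mat (incidence_entry w) xs' ys')))\<^sup>2 = pseudoforest_weight G w F"
    using leaf.prems xs' ys' by (intro leaf.IH) auto
  moreover have "(cmod (incidence_entry w v e))\<^sup>2 = cmod (w e)" using leaf.hyps(4) by (intro cmod_incidence_entry) auto
  ultimately show ?case
    unfolding det_pendant[OF o(1) leaf.hyps(2-4) o(2) leaf.prems(2-) xs' ys' pseudoforest_card[OF leaf.hyps(1)]]
      pseudoforest_weight_pendant[OF o(1) leaf.hyps(2-4)] by (simp add: power_mult_distrib)
next
  case (cycle V F p C)
  have o: "oriented_on V F" "R \<subseteq> V" using pseudoforest_orient[OF cycle.hyps(1)] by auto
  have fin: "finite (V - R)" "finite F" using oriented_on_finite[OF o(1)] by auto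
  obtain xs' where xs': "distinct xs'" "set xs' = V - R" using finite_distinct_list[OF fin(1)] by blast
  obtain ys' where ys': "distinct ys'" "set ys' = F" using finite_distinct_list[OF fin(2)] by blast
  have "(cmod (det (list_mat (incidence_entry w) xs' ys')))\<^sup>2 = pseudoforest_weight G w F"
    using cycle.prems xs' ys' by (intro cycle.IH) auto
  moreover have CG: "parcs C \<subseteq> parcs G" using cycle.prems(1) by simp
  ultimately show ?case
    using det_disjoint_cycle[where w = w, OF assms(1,2) o(1) cycle.hyps(2-4) o(2) CG cycle.prems(2-) xs' ys' pseudoforest_card[OF cycle.hyps(1)]]
      pseudoforest_weight_disjoint_cycle[OF o(1) cycle.hyps(2-4), of G w] by simp
qed

text \<open>Stripping a pendant vertex or a cycle exhibits the smaller minor as a factor, so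
  non-vanishing is inherited; a vertex without arcs would give a zero row. The property quantifies
  over enumerations so that it speaks of the sets \<open>V\<close> and \<open>F\<close>
  only.\<close>

lemma det_nonzero_imp_pseudoforest:
  fixes G :: "'a pair_pre_digraph"
  assumes G: "oriented_on V' (parcs G)" "\<And>e. e \<in> parcs G \<Longrightarrow> w e \<notin> neg_reals"
    and "oriented_on V F" "R \<subseteq> V" "F \<subseteq> parcs G" "card F + card R = card V"
    and "distinct xs" "set xs = V - R" "distinct ys" "set ys = F"
    and "det (list_mat (incidence_entry w) xs ys) \<noteq> 0"
  shows "pseudoforest R V F"
proof (rule hereditary_imp_pseudoforest[of "\<lambda>V F. oriented_on V F \<and> R \<subseteq> V \<and> F \<subseteq> parcs G \<and> card F + card R = card V \<and>
    (\<exists>xs ys. distinct xs \<and> set xs = V - R \<and> distinct ys \<and> set ys = F \<and> det (list_mat (incidence_entry w) xs ys) \<noteq> 0)"])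
  fix V F
  assume P: "oriented_on V F \<and> R \<subseteq> V \<and> F \<subseteq> parcs G \<and> card F + card R = card V \<and>
    (\<exists>xs ys. distinct xs \<and> set xs = V - R \<and> distinct ys \<and> set ys = F \<and> det (list_mat (incidence_entry w) xs ys) \<noteq> 0)"
  then obtain xs ys where xy: "set xs = V - R" "set ys = F" "det (list_mat (incidence_entry w) xs ys) \<noteq> 0" by blast
  have "incident F v \<noteq> {}" if "v \<in> V - R" for v
  proof
    assume "incident F v = {}"
    have "incidence_entry w v y = 0" if "y \<in> set ys" for y
    proof -
      have "fst y \<noteq> v" "snd y \<noteq> v" using \<open>incident F v = {}\<close> that xy(2) unfolding incident_def by blast+
      then show ?thesis by (simp add: incidence_entry_def)
    qed
    then show False using det_list_mat_zero_row[of v xs ys "incidence_entry w"] xy that by simp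
  qed
  then show "oriented_on V F \<and> R \<subseteq> V \<and> card F + card R \<le> card V \<and> (\<forall>v\<in>V - R. incident F v \<noteq> {})"
    using P by simp
next
  fix V F v u e
  assume o: "oriented_on V F" "R \<subseteq> V" and l: "v \<notin> V" "u \<in> V" "e = (u, v) \<or> e = (v, u)"
    and P: "oriented_on (insert v V) (insert e F) \<and> R \<subseteq> insert v V \<and> insert e F \<subseteq> parcs G \<and>
      card (insert e F) + card R = card (insert v V) \<and>
      (\<exists>xs ys. distinct xs \<and> set xs = insert v V - R \<and> distinct ys \<and> set ys = insert e F \<and>
        det (list_mat (incidence_entry w) xs ys) \<noteq> 0)"
  then obtain xs ys where xy: "distinct xs" "set xs = insert v V - R" "distinct ys" "set ys = insert e F"
    "det (list_mat (incidence_entry w) xs ys) \<noteq> 0" by blast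
  have fin: "finite V" "finite F" using oriented_on_finite[OF o(1)] .
  have c: "card F + card R = card V" using P pendant_inc(2)[OF o(1) l] l(1) fin by simp
  obtain xs' where xs': "distinct xs'" "set xs' = V - R" using finite_distinct_list[of "V - R"] fin by blast
  obtain ys' where ys': "distinct ys'" "set ys' = F" using finite_distinct_list[OF fin(2)] by blast
  have "det (list_mat (incidence_entry w) xs' ys') \<noteq> 0"
    using det_pendant[OF o(1) l o(2) xy(1-4) xs' ys' c, of w] xy(5) by auto
  then show "oriented_on V F \<and> R \<subseteq> V \<and> F \<subseteq> parcs G \<and> card F + card R = card V \<and>
    (\<exists>xs ys. distinct xs \<and> set xs = V - R \<and> distinct ys \<and> set ys = F \<and> det (list_mat (incidence_entry w) xs ys) \<noteq> 0)"
    using o c xs' ys' P by blast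
next
  fix V F p C
  assume o: "oriented_on V F" "R \<subseteq> V" and l: "goes_around p C" "oriented_on (pverts C) (parcs C)" "pverts C \<inter> V = {}"
    and P: "oriented_on (V \<union> pverts C) (F \<union> parcs C) \<and> R \<subseteq> V \<union> pverts C \<and> F \<union> parcs C \<subseteq> parcs G \<and>
      card (F \<union> parcs C) + card R = card (V \<union> pverts C) \<and>
      (\<exists>xs ys. distinct xs \<and> set xs = V \<union> pverts C - R \<and> distinct ys \<and> set ys = F \<union> parcs C \<and>
        det (list_mat (incidence_entry w) xs ys) \<noteq> 0)"
  then obtain xs ys where xy: "distinct xs" "set xs = V \<union> pverts C - R" "distinct ys" "set ys = F \<union> parcs C"
    "det (list_mat (incidence_entry w) xs ys) \<noteq> 0" by blast
  have fin: "finite V" "finite F" "finite (pverts C)" "finite (parcs C)"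
    using oriented_on_finite[OF o(1)] oriented_on_finite[OF l(2)] by auto
  obtain k ed where "pverts C = (!) p ` {..<k}" "inj_on ((!) p) {..<k}"
    "parcs C = ed ` {..<k}" "inj_on ed {..<k}"
    using goes_around_index[OF l(1,2)] by metis
  then have "card (pverts C) = card (parcs C)" by (simp add: card_image)
  moreover have "F \<inter> parcs C = {}" using o l(2,3) by (auto simp: oriented_on_def)
  ultimately have c: "card F + card R = card V"
    using P l(3) fin by (simp add: card_Un_disjoint Int_commute)
  obtain xs' where xs': "distinct xs'" "set xs' = V - R" using finite_distinct_list[of "V - R"] fin by blast
  obtain ys' where ys': "distinct ys'" "set ys' = F" using finite_distinct_list[OF fin(2)] by blast
  have CG: "parcs C \<subseteq> parcs G" using P by simp
  have "det (list_mat (incidence_entry w) xs' ys') \<noteq> 0"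
    using det_disjoint_cycle[where w = w, OF G o(1) l o(2) CG xy(1-4) xs' ys' c] xy(5) by auto
  then show "oriented_on V F \<and> R \<subseteq> V \<and> F \<subseteq> parcs G \<and> card F + card R = card V \<and>
    (\<exists>xs ys. distinct xs \<and> set xs = V - R \<and> distinct ys \<and> set ys = F \<and> det (list_mat (incidence_entry w) xs ys) \<noteq> 0)"
    using o c xs' ys' P by blast
qed (use assms in blast)


section \<open>Weak components\<close>

text \<open>Reachability of digraphs is reflexive only on the vertex set; once the start lies there,
  it is the ordinary closure.\<close>

lemma rtrancl_on_eq_rtrancl:
  assumes "r \<subseteq> A \<times> A" "u \<in> A"
  shows "(u, v) \<in> rtrancl_on A r \<longleftrightarrow> (u, v) \<in> r\<^sup>*"
proof
  assume "(u, v) \<in> rtrancl_on A r"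
  then show "(u, v) \<in> r\<^sup>*"
    by (induction rule: rtrancl_on_induct) (auto intro: rtrancl.rtrancl_into_rtrancl)
next
  assume "(u, v) \<in> r\<^sup>*"
  then show "(u, v) \<in> rtrancl_on A r"
  proof (induction rule: rtrancl_induct)
    case base
    then show ?case using assms(2) by simp
  next
    case (step y z)
    then show ?case using assms(1) by (auto intro: rtrancl_on_into_rtrancl_on)
  qed
qed

lemma weakly_connected_iff:
  assumes "parcs U \<subseteq> pverts U \<times> pverts U"
  shows "weakly_connected U \<longleftrightarrow> pverts U \<noteq> {} \<and> (\<forall>u\<in>pverts U. \<forall>v\<in>pverts U. (u, v) \<in> joined (parcs U))"
proof -
  have "parcs U \<union> (parcs U)\<inverse> \<subseteq> pverts U \<times> pverts U" using assms by auto
  from rtrancl_on_eq_rtrancl[OF this] show ?thesis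
    unfolding connected_def strongly_connected_def reachable_def with_proj_simps
      parcs_mk_symmetric_with_proj pverts_mk_symmetric by simp
qed

lemma subgraph_with_proj_iff:
  "subgraph (with_proj A) (with_proj B) \<longleftrightarrow> pverts A \<subseteq> pverts B \<and> parcs A \<subseteq> parcs B \<and>
     parcs A \<subseteq> pverts A \<times> pverts A \<and> parcs B \<subseteq> pverts B \<times> pverts B"
  unfolding subgraph_def wf_digraph_wp_iff pair_wf_digraph_def compatible_def by auto

text \<open>Maximality in \<open>weak_components\<close> ranges over general digraphs. A subgraph
  inherits the tail and head maps, so each competitor is again of the pair form.\<close>

lemma subgraph_imp_with_proj:
  assumes "subgraph H (with_proj G)"
  obtains K where "H = with_proj K"
proof
  show "H = with_proj \<lparr>pverts = verts H, parcs = arcs H\<rparr>"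
    using assms unfolding subgraph_def compatible_def with_proj_def by simp
qed

lemma is_cycle_of_iff:
  assumes "oriented_on (pverts H) (parcs H)"
  shows "is_cycle_of C H \<longleftrightarrow> C \<in> cycles_in (parcs H)"
proof
  assume "is_cycle_of C H"
  then show "C \<in> cycles_in (parcs H)" unfolding is_cycle_of_def subgraph_with_proj_iff cycles_in_def by blast
next
  assume C: "C \<in> cycles_in (parcs H)"
  have "pverts C \<subseteq> pverts H" by (rule cycles_in_pverts_subset[OF C assms])
  moreover have "parcs C \<subseteq> pverts C \<times> pverts C" using cycles_in_orient[OF C assms] by (simp add: oriented_on_def)
  moreover have "parcs H \<subseteq> pverts H \<times> pverts H" using assms by (simp add: oriented_on_def)
  ultimately show "is_cycle_of C H"
    using C unfolding is_cycle_of_def subgraph_with_proj_iff cycles_in_def by blast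
qed

text \<open>The weak component described by reachability. Testing the tail of an arc is enough,
  since its head is joined to it.\<close>

definition component :: "'a pair_pre_digraph \<Rightarrow> 'a \<Rightarrow> 'a pair_pre_digraph" where
  "component H v = \<lparr>pverts = {u. (v, u) \<in> joined (parcs H)}, parcs = {e \<in> parcs H. (v, fst e) \<in> joined (parcs H)}\<rparr>"

lemma component_eq:
  assumes "(v, u) \<in> joined (parcs H)"
  shows "component H v = component H u"
proof -
  have "(v, x) \<in> joined (parcs H) \<longleftrightarrow> (u, x) \<in> joined (parcs H)" for x
    using assms joined_sym[OF assms] by (meson rtrancl_trans)
  then show ?thesis unfolding component_def by simp
qed

lemma joined_arc: "(x, y) \<in> F \<Longrightarrow> (v, x) \<in> joined F \<longleftrightarrow> (v, y) \<in> joined F"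
proof -
  assume "(x, y) \<in> F"
  then have "(x, y) \<in> joined F" "(y, x) \<in> joined F" by auto
  then show ?thesis by (meson rtrancl_trans)
qed

context
  fixes H :: "'a pair_pre_digraph"
  assumes H: "oriented_on (pverts H) (parcs H)"
begin

lemma component_orient:
  assumes "v \<in> pverts H"
  shows "oriented_on (pverts (component H v)) (parcs (component H v))"
    and "pverts (component H v) \<subseteq> pverts H"
proof -
  show sub: "pverts (component H v) \<subseteq> pverts H"
  proof
    fix u assume "u \<in> pverts (component H v)"
    then have "(v, u) \<in> joined (parcs H)" by (simp add: component_def)
    from joined_closed[OF this assms] show "u \<in> pverts H" using H unfolding oriented_on_def by blast
  qed
  have "parcs (component H v) \<subseteq> pverts (component H v) \<times> pverts (component H v)"
    unfolding component_def using joined_arc[of _ _ "parcs H" v] by auto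
  then show "oriented_on (pverts (component H v)) (parcs (component H v))"
    using oriented_on_mono[OF H _ _ finite_subset[OF sub oriented_on_finite(1)[OF H]]] by (simp add: component_def)
qed

lemma component_connected:
  assumes "v \<in> pverts H" "x \<in> pverts (component H v)" "y \<in> pverts (component H v)"
  shows "(x, y) \<in> joined (parcs (component H v))"
proof -
  have *: "(v, u) \<in> joined (parcs (component H v))" if "u \<in> pverts (component H v)" for u
  proof -
    have "(v, u) \<in> joined (parcs H)" using that by (simp add: component_def)
    then have "(v, u) \<in> joined {e \<in> parcs H. fst e \<in> pverts (component H v)}"
    proof (rule joined_closed[THEN conjunct2])
      show "v \<in> pverts (component H v)" by (simp add: component_def)
      fix x y assume "(x, y) \<in> parcs H"
      then show "x \<in> pverts (component H v) \<longleftrightarrow> y \<in> pverts (component H v)"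
        using joined_arc[of x y "parcs H" v] by (simp add: component_def)
    qed
    then show ?thesis by (simp add: component_def)
  qed
  show ?thesis by (rule rtrancl_trans[OF joined_sym[OF *[OF assms(2)]] *[OF assms(3)]])
qed

lemma component_weakly_connected: "v \<in> pverts H \<Longrightarrow> weakly_connected (component H v)"
  using component_connected component_orient(1)[of v]
  by (subst weakly_connected_iff) (auto simp: oriented_on_def component_def)

lemma component_subgraph: "v \<in> pverts H \<Longrightarrow> subgraph (with_proj (component H v)) (with_proj H)"
  unfolding subgraph_with_proj_iff
  using component_orient[of v] H by (auto simp: oriented_on_def) (auto simp: component_def)

lemma connected_subgraph_component:
  assumes "subgraph (with_proj K) (with_proj H)" "weakly_connected K" "v \<in> pverts K"
  shows "pverts K \<subseteq> pverts (component H v)" "parcs K \<subseteq> parcs (component H v)"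
proof -
  have K: "parcs K \<subseteq> parcs H" "parcs K \<subseteq> pverts K \<times> pverts K"
    using assms(1) unfolding subgraph_with_proj_iff by auto
  have *: "(v, u) \<in> joined (parcs H)" if "u \<in> pverts K" for u
    using assms(2,3) that joined_mono[OF K(1), of v u] unfolding weakly_connected_iff[OF K(2)] by blast
  then show "pverts K \<subseteq> pverts (component H v)" by (auto simp: component_def)
  show "parcs K \<subseteq> parcs (component H v)"
  proof
    fix e assume "e \<in> parcs K"
    moreover from this have "fst e \<in> pverts K" using K(2) by auto
    ultimately show "e \<in> parcs (component H v)" using * K(1) by (auto simp: component_def)
  qed
qed

text \<open>Any connected subgraph through \<open>v\<close> is contained in
  \<open>component H v\<close>, which is itself connected; so these are precisely the maximal
  connected subgraphs.\<close>

lemma weak_components_eq: "weak_components H = component H ` pverts H"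
proof (intro equalityI subsetI)
  fix U assume "U \<in> weak_components H"
  then have sub: "subgraph (with_proj U) (with_proj H)" and con: "weakly_connected U"
    and mx: "\<And>H'. H' \<noteq> with_proj U \<Longrightarrow> subgraph (with_proj U) H' \<Longrightarrow> subgraph H' (with_proj H) \<Longrightarrow>
      \<not> Digraph_Component.connected H'"
    unfolding weak_components_def pre_digraph.max_subgraph_def by blast+
  have Uw: "parcs U \<subseteq> pverts U \<times> pverts U" and UH: "pverts U \<subseteq> pverts H"
    using sub unfolding subgraph_with_proj_iff by auto
  obtain v where v: "v \<in> pverts U" using con unfolding weakly_connected_iff[OF Uw] by blast
  then have vH: "v \<in> pverts H" using UH by auto
  have "subgraph (with_proj U) (with_proj (component H v))"
    using connected_subgraph_component[OF sub con v] Uw component_orient(1)[OF vH]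
    unfolding subgraph_with_proj_iff oriented_on_def by blast
  then have "with_proj (component H v) = with_proj U"
    using mx[OF _ _ component_subgraph[OF vH]] component_weakly_connected[OF vH] by blast
  then have "component H v = U" unfolding with_proj_def by simp
  then show "U \<in> component H ` pverts H" using vH by blast
next
  fix U assume "U \<in> component H ` pverts H"
  then obtain v where v: "v \<in> pverts H" "U = component H v" by auto
  have "\<not> Digraph_Component.connected K"
    if K: "K \<noteq> with_proj U" "subgraph (with_proj U) K" "subgraph K (with_proj H)" for K
  proof
    assume con: "Digraph_Component.connected K"
    obtain K' where K': "K = with_proj K'" using subgraph_imp_with_proj[OF K(3)] .
    have UK: "pverts U \<subseteq> pverts K'" "parcs U \<subseteq> parcs K'"
      using K(2) unfolding K' subgraph_with_proj_iff by auto
    have "v \<in> pverts K'" using UK v by (auto simp: component_def)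
    from connected_subgraph_component[OF K(3)[unfolded K'] con[unfolded K'] this]
    have "K' = U" using UK unfolding v(2)[symmetric] by simp
    then show False using K(1) K' by simp
  qed
  then show "U \<in> weak_components H"
    using component_subgraph[OF v(1)] component_weakly_connected[OF v(1)] v(2)
    unfolding weak_components_def pre_digraph.max_subgraph_def by blast
qed

lemma cycles_in_component:
  assumes "v \<in> pverts H"
  shows "C \<in> cycles_in (parcs (component H v)) \<longleftrightarrow> C \<in> cycles_in (parcs H) \<and> reaches (parcs H) v C"
proof
  assume C: "C \<in> cycles_in (parcs (component H v))"
  have "cycles_in (parcs (component H v)) \<subseteq> cycles_in (parcs H)" by (rule cycles_in_mono) (auto simp: component_def)
  moreover have "pverts C \<subseteq> pverts (component H v)"
    by (rule cycles_in_pverts_subset[OF C component_orient(1)[OF assms]])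
  then have "reaches (parcs H) v C"
    using cycles_in_pverts_nonempty[OF C] unfolding reaches_def component_def by auto
  ultimately show "C \<in> cycles_in (parcs H) \<and> reaches (parcs H) v C" using C by blast
next
  assume C: "C \<in> cycles_in (parcs H) \<and> reaches (parcs H) v C"
  then have "parcs C \<subseteq> pverts C \<times> pverts C" using cycles_in_orient H unfolding oriented_on_def by blast
  moreover have "(v, u) \<in> joined (parcs H)" if "u \<in> pverts C" for u
    using reaches_cycle[OF _ H _ that] C by blast
  ultimately have "parcs C \<subseteq> parcs (component H v)" using C by (auto simp: component_def cycles_in_def)
  then show "C \<in> cycles_in (parcs (component H v))" using C unfolding cycles_in_def by blast
qed

lemma is_cycle_of_component:
  assumes "v \<in> pverts H"
  shows "is_cycle_of C (component H v) \<longleftrightarrow> C \<in> cycles_in (parcs H) \<and> reaches (parcs H) v C"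
  using is_cycle_of_iff[OF component_orient(1)[OF assms]] cycles_in_component[OF assms] by simp

text \<open>Without roots the cores are the cycles, and a cycle lies in the component of
  \<open>v\<close> exactly when \<open>v\<close> reaches it.\<close>

lemma all_unicyclic_iff:
  "(\<forall>U\<in>weak_components H. unicyclic U) \<longleftrightarrow> one_core {} (pverts H) (parcs H)"
  unfolding weak_components_eq unicyclic_def one_core_def cores_def
  using component_weakly_connected is_cycle_of_component by simp

text \<open>Uniqueness of the core makes \<open>the_cycle\<close> a bijection from components to
  cycles, and the arcs off the cycles are partitioned by component; the product is then merely
  regrouped.\<close>

lemma prod_components_eq_pseudoforest_weight:
  assumes "one_core {} (pverts H) (parcs H)"
  shows "(\<Prod>U\<in>weak_components H. 2 * cmod (weight_product w (remove_edges U (the_cycle U))) *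
    cycle_alpha G w (the_cycle U)) = pseudoforest_weight G w (parcs H)"
proof -
  define c where "c = (\<lambda>v. the_cycle (component H v))"
  have ex1: "\<exists>!C. C \<in> cycles_in (parcs H) \<and> reaches (parcs H) v C" if "v \<in> pverts H" for v
    using assms that by (simp add: one_core_def cores_def)
  have c: "c v \<in> cycles_in (parcs H)" "reaches (parcs H) v (c v)" if "v \<in> pverts H" for v
    using theI'[OF ex1[OF that]] by (simp_all add: c_def the_cycle_def is_cycle_of_component[OF that])
  have c_eq: "C = c v" if "v \<in> pverts H" "C \<in> cycles_in (parcs H)" "reaches (parcs H) v C" for v C
    using ex1[OF that(1)] c[OF that(1)] that(2,3) by blast
  have comp_c: "component H v = component H u" if "v \<in> pverts H" "u \<in> pverts (c v)" for u v
    by (rule component_eq[OF reaches_cycle[OF c(1) H c(2)]]) (use that in auto)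
  have FV: "parcs H \<subseteq> pverts H \<times> pverts H" using H by (simp add: oriented_on_def)
  have inj: "inj_on the_cycle (weak_components H)"
  proof (rule inj_onI)
    fix U U' assume "U \<in> weak_components H" "U' \<in> weak_components H" and eq: "the_cycle U = the_cycle U'"
    then obtain v v' where v: "v \<in> pverts H" "U = component H v" "v' \<in> pverts H" "U' = component H v'"
      unfolding weak_components_eq by blast
    have "c v = c v'" using eq v by (simp add: c_def)
    moreover obtain u where "u \<in> pverts (c v)" using cycles_in_pverts_nonempty[OF c(1)[OF v(1)]] by blast
    ultimately show "U = U'" using comp_c[OF v(1), of u] comp_c[OF v(3), of u] v(2,4) by simp
  qed
  have img: "the_cycle ` weak_components H = cycles_in (parcs H)"
  proof (intro equalityI subsetI)
    fix C assume "C \<in> the_cycle ` weak_components H"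
    then show "C \<in> cycles_in (parcs H)" using c(1) unfolding weak_components_eq c_def by auto
  next
    fix C assume C: "C \<in> cycles_in (parcs H)"
    obtain u where u: "u \<in> pverts C" using cycles_in_pverts_nonempty[OF C] by blast
    then have uH: "u \<in> pverts H" using cycles_in_pverts_subset[OF C H] by blast
    have "C = c u" by (rule c_eq[OF uH C]) (use u in \<open>auto simp: reaches_def\<close>)
    then show "C \<in> the_cycle ` weak_components H" using uH unfolding weak_components_eq c_def by blast
  qed
  have part: "parcs H - (\<Union>C\<in>cycles_in (parcs H). parcs C) =
    (\<Union>U\<in>weak_components H. parcs U - parcs (the_cycle U))"
  proof (intro equalityI subsetI)
    fix e assume e: "e \<in> parcs H - (\<Union>C\<in>cycles_in (parcs H). parcs C)"
    then have v: "fst e \<in> pverts H" using FV by auto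
    have "e \<in> parcs (component H (fst e))" using e by (simp add: component_def)
    moreover have "e \<notin> parcs (the_cycle (component H (fst e)))" using c(1)[OF v] e by (auto simp: c_def)
    ultimately show "e \<in> (\<Union>U\<in>weak_components H. parcs U - parcs (the_cycle U))"
      using v unfolding weak_components_eq by blast
  next
    fix e assume "e \<in> (\<Union>U\<in>weak_components H. parcs U - parcs (the_cycle U))"
    then obtain v where v: "v \<in> pverts H" "e \<in> parcs (component H v)" "e \<notin> parcs (c v)"
      unfolding weak_components_eq c_def by blast
    have "e \<notin> parcs C" if C: "C \<in> cycles_in (parcs H)" for C
    proof
      assume e: "e \<in> parcs C"
      have "fst e \<in> pverts C" using cycles_in_orient[OF C H] e by (auto simp: oriented_on_def)
      then have "reaches (parcs H) v C" using v(2) by (auto simp: reaches_def component_def)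
      then have "C = c v" by (rule c_eq[OF v(1) C])
      then show False using e v(3) by simp
    qed
    then show "e \<in> parcs H - (\<Union>C\<in>cycles_in (parcs H). parcs C)" using v(2) by (auto simp: component_def)
  qed
  have fin: "finite (weak_components H)" using oriented_on_finite[OF H] unfolding weak_components_eq by simp
  have "(\<Prod>e\<in>parcs H - (\<Union>C\<in>cycles_in (parcs H). parcs C). cmod (w e)) =
    (\<Prod>U\<in>weak_components H. \<Prod>e\<in>parcs U - parcs (the_cycle U). cmod (w e))"
    unfolding part
  proof (rule prod.UNION_disjoint[OF fin])
    show "\<forall>U\<in>weak_components H. finite (parcs U - parcs (the_cycle U))"
      using oriented_on_finite(2)[OF component_orient(1)] unfolding weak_components_eq by auto
    show "\<forall>U\<in>weak_components H. \<forall>U'\<in>weak_components H. U \<noteq> U' \<longrightarrow>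
      (parcs U - parcs (the_cycle U)) \<inter> (parcs U' - parcs (the_cycle U')) = {}"
    proof (intro ballI impI, rule ccontr)
      fix U U' assume UU': "U \<in> weak_components H" "U' \<in> weak_components H" "U \<noteq> U'"
        and "(parcs U - parcs (the_cycle U)) \<inter> (parcs U' - parcs (the_cycle U')) \<noteq> {}"
      then obtain e where e: "e \<in> parcs U" "e \<in> parcs U'" by blast
      obtain v v' where v: "U = component H v" "U' = component H v'"
        using UU' unfolding weak_components_eq by blast
      have "U = component H (fst e)" "U' = component H (fst e)"
        using e component_eq[of v "fst e" H] component_eq[of v' "fst e" H] unfolding v
        by (simp_all add: component_def)
      then show False using UU'(3) by simp
    qed
  qed
  also have "\<dots> = (\<Prod>U\<in>weak_components H. cmod (weight_product w (remove_edges U (the_cycle U))))"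
    by (simp add: weight_product_def remove_edges_def prod_norm)
  finally have 1: "(\<Prod>e\<in>parcs H - (\<Union>C\<in>cycles_in (parcs H). parcs C). cmod (w e)) = \<dots>" .
  have 2: "(\<Prod>C\<in>cycles_in (parcs H). 2 * cycle_alpha G w C) =
    (\<Prod>U\<in>weak_components H. 2 * cycle_alpha G w (the_cycle U))"
    unfolding img[symmetric] by (simp add: prod.reindex[OF inj])
  show ?thesis unfolding pseudoforest_weight_def 1 2 prod.distrib[symmetric] by (simp add: mult_ac)
qed

end

text \<open>In the absence of cycles the only core is the root, so reaching exactly one core means
  being joined to \<open>r\<close>, that is, weak connectedness. The left side does not mention
  \<open>r\<close>: each vertex serves equally well as root.\<close>

lemma oriented_spanning_tree_iff:
  assumes G: "oriented_on (pverts G) (parcs G)" and r: "r \<in> pverts G"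
  shows "T \<in> oriented_spanning_trees G \<longleftrightarrow>
    pverts T = pverts G \<and> parcs T \<subseteq> parcs G \<and> pseudoforest {r} (pverts G) (parcs T) \<and> cycles_in (parcs T) = {}"
proof -
  have GV: "parcs G \<subseteq> pverts G \<times> pverts G" using G by (simp add: oriented_on_def)
  have span: "T \<in> subgraphs_spanning G \<longleftrightarrow> pverts T = pverts G \<and> parcs T \<subseteq> parcs G"
    unfolding subgraphs_spanning_def spanning_def mem_Collect_eq subgraph_with_proj_iff
    using GV by auto
  have main: "weakly_connected T \<and> (\<nexists>C. is_cycle_of C T) \<longleftrightarrow>
      pseudoforest {r} (pverts G) (parcs T) \<and> cycles_in (parcs T) = {}"
    if T: "pverts T = pverts G" "parcs T \<subseteq> parcs G"
  proof -
    have oT: "oriented_on (pverts T) (parcs T)" using G T(2) unfolding oriented_on_def T(1) by blast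
    have Tw: "parcs T \<subseteq> pverts T \<times> pverts T" using oT by (simp add: oriented_on_def)
    have cyc: "(\<nexists>C. is_cycle_of C T) \<longleftrightarrow> cycles_in (parcs T) = {}"
      unfolding is_cycle_of_iff[OF oT] by blast
    have "weakly_connected T \<longleftrightarrow> pseudoforest {r} (pverts G) (parcs T)" if C: "cycles_in (parcs T) = {}"
    proof -
      have core: "one_core {r} (pverts G) (parcs T) \<longleftrightarrow> (\<forall>v\<in>pverts G. (v, r) \<in> joined (parcs T))"
        unfolding one_core_def cores_def C reaches_def by auto
      show ?thesis
      proof
        assume "weakly_connected T"
        then have "one_core {r} (pverts G) (parcs T)"
          unfolding core weakly_connected_iff[OF Tw] using r T(1) by blast
        then show "pseudoforest {r} (pverts G) (parcs T)"
          using oT T(1) r by (intro one_core_imp_pseudoforest) auto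
      next
        assume "pseudoforest {r} (pverts G) (parcs T)"
        then have *: "(v, r) \<in> joined (parcs T)" if "v \<in> pverts G" for v
          using pseudoforest_imp_one_core core that by blast
        show "weakly_connected T"
          unfolding weakly_connected_iff[OF Tw]
        proof (intro conjI ballI)
          show "pverts T \<noteq> {}" using r T(1) by blast
          fix u v assume "u \<in> pverts T" "v \<in> pverts T"
          then show "(u, v) \<in> joined (parcs T)"
            using rtrancl_trans[OF *[of u] joined_sym[OF *[of v]]] T(1) by simp
        qed
      qed
    qed
    then show ?thesis using cyc by blast
  qed
  show ?thesis unfolding oriented_spanning_trees_def mem_Collect_eq span using main by blast
qed

lemma unicyclic_spanning_subgraph_iff:
  assumes G: "oriented_on (pverts G) (parcs G)"
  shows "H \<in> unicyclic_spanning_subgraphs G \<longleftrightarrow>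
    pverts H = pverts G \<and> parcs H \<subseteq> parcs G \<and> pseudoforest {} (pverts G) (parcs H)"
proof -
  have GV: "parcs G \<subseteq> pverts G \<times> pverts G" using G by (simp add: oriented_on_def)
  have span: "H \<in> subgraphs_spanning G \<longleftrightarrow> pverts H = pverts G \<and> parcs H \<subseteq> parcs G \<and>
      parcs H \<subseteq> pverts H \<times> pverts H"
    unfolding subgraphs_spanning_def spanning_def mem_Collect_eq subgraph_with_proj_iff
    using GV by auto
  have "(\<forall>U\<in>weak_components H. unicyclic U) \<longleftrightarrow> pseudoforest {} (pverts G) (parcs H)"
    if T: "pverts H = pverts G" "parcs H \<subseteq> parcs G"
  proof -
    have o: "oriented_on (pverts H) (parcs H)" using G T(2) unfolding oriented_on_def T(1) by blast
    show ?thesis unfolding all_unicyclic_iff[OF o]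
      using one_core_imp_pseudoforest[OF o, of "{}"] pseudoforest_imp_one_core[of "{}" "pverts H" "parcs H"] T(1) by auto
  qed
  then show ?thesis unfolding unicyclic_spanning_subgraphs_def mem_Collect_eq span
    using GV by blast
qed


section \<open>Rank and volume\<close>

text \<open>A maximal independent set of columns has as many elements as the rank. If this is the
  number of rows, these columns form an invertible square matrix.\<close>

lemma rank_list_mat:
  fixes f :: "'a \<Rightarrow> 'b \<Rightarrow> complex"
  shows "vec_space.rank (length xs) (list_mat f xs es) \<le> length xs"
    and "vec_space.rank (length xs) (list_mat f xs es) = length xs \<Longrightarrow>
      \<exists>ys. distinct ys \<and> set ys \<subseteq> set es \<and> length ys = length xs \<and> det (list_mat f xs ys) \<noteq> 0"
proof -
  define n where "n = length xs"
  interpret vec_space "TYPE(complex)" n .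
  define c where "c = (\<lambda>y. vec n (\<lambda>i. f (xs ! i) y))"
  have cols: "cols (list_mat f xs ys) = map c ys" for ys
    by (rule nth_equalityI) (auto simp: list_mat_def c_def n_def)
  have A: "list_mat f xs ys \<in> carrier_mat n (length ys)" for ys by (simp add: list_mat_def n_def)
  obtain S where mx: "maximal S (\<lambda>T. T \<subseteq> set (cols (list_mat f xs es)) \<and> lin_indpt T)"
    using maximal_exists_superset[of "set (cols (list_mat f xs es))"
        "\<lambda>T. T \<subseteq> set (cols (list_mat f xs es)) \<and> lin_indpt T" "{}"] finite_lin_indpt2[of "{}"] by auto
  then have S: "S \<subseteq> set (cols (list_mat f xs es))" "lin_indpt S" unfolding maximal_def by auto
  have rk: "rank (list_mat f xs es) = card S" by (rule rank_card_indpt[OF A mx])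
  have Sc: "S \<subseteq> carrier_vec n" using S(1) unfolding cols c_def by auto
  have "card S \<le> n" using li_le_dim(2)[OF fin_dim, of S] Sc S(2) by (simp add: dim_is_n)
  then show "vec_space.rank (length xs) (list_mat f xs es) \<le> length xs" using rk by (simp add: n_def)
  assume "vec_space.rank (length xs) (list_mat f xs es) = length xs"
  then have cS: "card S = n" using rk by (simp add: n_def)
  have "S \<subseteq> c ` set es" using S(1) unfolding cols by simp
  \<comment> \<open>Different indices may carry the same column vector, so \<open>Y\<close> picks
    one index for each vector of \<open>S\<close>.\<close>
  then obtain Y where Y: "Y \<subseteq> set es" "inj_on c Y" "S = c ` Y" by (auto simp: subset_image_inj)
  obtain ys where ys: "distinct ys" "set ys = Y"
    using finite_distinct_list[of Y] finite_subset[OF Y(1)] by blast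
  have len: "length ys = n" using distinct_card[OF ys(1)] cS Y(2,3) ys(2) by (simp add: card_image)
  have "distinct (cols (list_mat f xs ys))" using ys Y(2) unfolding cols by (simp add: distinct_map)
  moreover have "set (cols (list_mat f xs ys)) = S" unfolding cols using ys Y(3) by simp
  ultimately have "rank (list_mat f xs ys) = n"
    using lin_indpt_full_rank[OF A, of ys] S(2) len by simp
  then have "det (list_mat f xs ys) \<noteq> 0" using det_rank_iff[of "list_mat f xs ys"] A[of ys] len by simp
  then show "\<exists>ys. distinct ys \<and> set ys \<subseteq> set es \<and> length ys = length xs \<and> det (list_mat f xs ys) \<noteq> 0"
    using ys Y(1) len by (intro exI[of _ ys]) (simp add: n_def)
qed

text \<open>\<open>submatrix\<close> numbers the rows and columns it keeps by \<open>pick\<close>;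
  this turns the numbering into an enumeration of the index set.\<close>

lemma bij_betw_pick:
  assumes "finite I"
  shows "bij_betw (pick I) {..<card I} I"
proof -
  have inj: "inj_on (pick I) {..<card I}"
  proof (rule linorder_inj_onI)
    fix i j assume "i < j" "i \<in> {..<card I}" "j \<in> {..<card I}"
    then show "pick I i \<noteq> pick I j" using pick_mono_le[of j I i] by simp
  qed auto
  have "pick I ` {..<card I} \<subseteq> I" using pick_in_set_le by auto
  then have "pick I ` {..<card I} = I" using inj assms by (intro card_subset_eq) (simp_all add: card_image)
  then show ?thesis using inj by (simp add: bij_betw_def)
qed

lemma submatrix_list_mat:
  assumes "I \<subseteq> {..<length xs}" "J \<subseteq> {..<length es}" "distinct xs" "distinct es"
  obtains xs' ys where "submatrix (list_mat f xs es) I J = list_mat f xs' ys"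
    "distinct xs'" "set xs' = (!) xs ` I" "distinct ys" "set ys = (!) es ` J"
proof
  have fin: "finite I" "finite J" using assms(1,2) finite_subset by auto
  have I: "{i. i < length xs \<and> i \<in> I} = I" "{j. j < length es \<and> j \<in> J} = J" using assms(1,2) by auto
  have pI: "inj_on (pick I) {..<card I}" "pick I ` {..<card I} = I"
    and pJ: "inj_on (pick J) {..<card J}" "pick J ` {..<card J} = J"
    using bij_betw_pick[OF fin(1)] bij_betw_pick[OF fin(2)] by (auto simp: bij_betw_def)
  have lt: "i < card I \<Longrightarrow> pick I i < length xs" "j < card J \<Longrightarrow> pick J j < length es" for i j
    using pick_in_set_le[of i I] pick_in_set_le[of j J] assms(1,2) by auto
  define xs' where "xs' = map (\<lambda>i. xs ! pick I i) [0..<card I]"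
  define ys where "ys = map (\<lambda>j. es ! pick J j) [0..<card J]"
  show "submatrix (list_mat f xs es) I J = list_mat f xs' ys"
    unfolding submatrix_def using I lt by (intro eq_matI) (auto simp: list_mat_def xs'_def ys_def)
  have "inj_on ((!) xs) I" "inj_on ((!) es) J" using assms by (auto intro: inj_on_nth)
  then have "inj_on (\<lambda>i. xs ! pick I i) {..<card I}" "inj_on (\<lambda>j. es ! pick J j) {..<card J}"
    using comp_inj_on[OF pI(1)] comp_inj_on[OF pJ(1)] pI(2) pJ(2) unfolding comp_def by simp_all
  then show "distinct xs'" "distinct ys" by (simp_all add: xs'_def ys_def distinct_map atLeast0LessThan)
  have "set xs' = (!) xs ` pick I ` {..<card I}" "set ys = (!) es ` pick J ` {..<card J}"
    unfolding xs'_def ys_def set_map image_image by (auto simp: atLeast0LessThan)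
  then show "set xs' = (!) xs ` I" "set ys = (!) es ` J" unfolding pI(2) pJ(2) .
qed

text \<open>\<open>D\<close> expresses the squared minors through sets of labels, so that the sums
  over positions in \<open>vol2\<close> become sums over sets of vertices and of arcs.\<close>

lemma vol2_list_mat:
  assumes "distinct xs" "distinct es"
    and D: "\<And>xs' ys. distinct xs' \<Longrightarrow> set xs' \<subseteq> set xs \<Longrightarrow> distinct ys \<Longrightarrow> set ys \<subseteq> set es \<Longrightarrow>
      length xs' = r \<Longrightarrow> length ys = r \<Longrightarrow>
      (cmod (det (list_mat f xs' ys)))\<^sup>2 = D (set xs') (set ys)"
    and "vec_space.rank (length xs) (list_mat f xs es) = r"
  shows "vol2 (list_mat f xs es) = (\<Sum>X | X \<subseteq> set xs \<and> card X = r. \<Sum>F | F \<subseteq> set es \<and> card F = r. D X F)"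
proof -
  have val: "(cmod (det (submatrix (list_mat f xs es) I J)))\<^sup>2 = D ((!) xs ` I) ((!) es ` J)"
    if IJ: "I \<subseteq> {..<length xs}" "card I = r" "J \<subseteq> {..<length es}" "card J = r" for I J
  proof -
    obtain xs' ys where s: "submatrix (list_mat f xs es) I J = list_mat f xs' ys"
      "distinct xs'" "set xs' = (!) xs ` I" "distinct ys" "set ys = (!) es ` J"
      by (rule submatrix_list_mat[OF IJ(1,3) assms(1,2)])
    have "inj_on ((!) xs) I" "inj_on ((!) es) J" using assms(1,2) IJ by (auto intro: inj_on_nth)
    then have "length xs' = r" "length ys = r"
      using distinct_card[OF s(2)] distinct_card[OF s(4)] s(3,5) IJ(2,4) by (simp_all add: card_image)
    then show ?thesis unfolding s(1) s(3,5)[symmetric]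
      using s IJ(1,3) by (intro D) auto
  qed
  have reindex: "(\<Sum>I | I \<subseteq> {..<length zs} \<and> card I = r. g ((!) zs ` I)) = (\<Sum>X | X \<subseteq> set zs \<and> card X = r. g X)"
    if zs: "distinct zs" for zs :: "'c list" and g :: "'c set \<Rightarrow> real"
  proof (rule sum.reindex_bij_betw)
    have bij: "bij_betw ((!) zs) {..<length zs} (set zs)" by (rule bij_betw_nth[OF zs]) auto
    have inj: "inj_on ((!) zs) {..<length zs}" and im: "(!) zs ` {..<length zs} = set zs"
      using bij by (auto simp: bij_betw_def)
    have c: "card ((!) zs ` I) = card I" if "I \<subseteq> {..<length zs}" for I
      by (rule card_image[OF inj_on_subset[OF inj that]])
    show "bij_betw (\<lambda>I. (!) zs ` I) {I. I \<subseteq> {..<length zs} \<and> card I = r} {X. X \<subseteq> set zs \<and> card X = r}"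
      unfolding bij_betw_def
    proof
      show "inj_on (\<lambda>I. (!) zs ` I) {I. I \<subseteq> {..<length zs} \<and> card I = r}"
        by (rule inj_onI) (use inj_on_image_eq_iff[OF inj] in auto)
      show "(\<lambda>I. (!) zs ` I) ` {I. I \<subseteq> {..<length zs} \<and> card I = r} = {X. X \<subseteq> set zs \<and> card X = r}"
      proof (intro equalityI subsetI)
        fix X assume "X \<in> (\<lambda>I. (!) zs ` I) ` {I. I \<subseteq> {..<length zs} \<and> card I = r}"
        then show "X \<in> {X. X \<subseteq> set zs \<and> card X = r}" using c im by auto
      next
        fix X assume X: "X \<in> {X. X \<subseteq> set zs \<and> card X = r}"
        then have "X \<subseteq> (!) zs ` {..<length zs}" unfolding im by simp
        then obtain I where "I \<subseteq> {..<length zs}" "X = (!) zs ` I" by (auto simp: subset_image_iff)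
        then show "X \<in> (\<lambda>I. (!) zs ` I) ` {I. I \<subseteq> {..<length zs} \<and> card I = r}" using X c by auto
      qed
    qed
  qed
  have "vol2 (list_mat f xs es) = (\<Sum>I | I \<subseteq> {..<length xs} \<and> card I = r.
      \<Sum>J | J \<subseteq> {..<length es} \<and> card J = r. D ((!) xs ` I) ((!) es ` J))"
    unfolding vol2_def Let_def using assms(4) val by (simp add: list_mat_def)
  also have "\<dots> = (\<Sum>I | I \<subseteq> {..<length xs} \<and> card I = r. \<Sum>F | F \<subseteq> set es \<and> card F = r. D ((!) xs ` I) F)"
    using reindex[OF assms(2)] by simp
  also have "\<dots> = (\<Sum>X | X \<subseteq> set xs \<and> card X = r. \<Sum>F | F \<subseteq> set es \<and> card F = r. D X F)"
    using reindex[OF assms(1), of "\<lambda>X. \<Sum>F | F \<subseteq> set es \<and> card F = r. D X F"] by simp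
  finally show ?thesis .
qed

lemma image_nth_eq:
  assumes "X \<subseteq> set zs"
  shows "(!) zs ` {i. i < length zs \<and> zs ! i \<in> X} = X"
proof (intro equalityI subsetI)
  fix x assume x: "x \<in> X"
  then obtain i where "i < length zs" "zs ! i = x" using assms by (metis in_set_conv_nth subsetD)
  then show "x \<in> (!) zs ` {i. i < length zs \<and> zs ! i \<in> X}" using x by blast
qed auto

text \<open>The given lists may be in any order; the genuine submatrix on the same labels has a
  determinant of the same modulus, hence is also regular.\<close>

lemma rank_list_mat_ge:
  fixes f :: "'a \<Rightarrow> 'b \<Rightarrow> complex"
  assumes "distinct xs" "distinct es" "distinct xs'" "set xs' \<subseteq> set xs" "distinct ys" "set ys \<subseteq> set es"
    and "det (list_mat f xs' ys) \<noteq> 0"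
  shows "length ys \<le> vec_space.rank (length xs) (list_mat f xs es)"
proof -
  define I where "I = {i. i < length xs \<and> xs ! i \<in> set xs'}"
  define J where "J = {j. j < length es \<and> es ! j \<in> set ys}"
  have im: "(!) xs ` I = set xs'" "(!) es ` J = set ys"
    unfolding I_def J_def by (rule image_nth_eq[OF assms(4)], rule image_nth_eq[OF assms(6)])
  obtain zs vs where s: "submatrix (list_mat f xs es) I J = list_mat f zs vs"
    "distinct zs" "set zs = (!) xs ` I" "distinct vs" "set vs = (!) es ` J"
    by (rule submatrix_list_mat[of I xs J es f]) (use assms in \<open>auto simp: I_def J_def\<close>)
  have "cmod (det (list_mat f zs vs)) = cmod (det (list_mat f xs' ys))"
    by (rule cmod_det_list_mat_cong) (use s assms im in auto)
  then have "det (submatrix (list_mat f xs es) I J) \<noteq> 0" using assms(7) s(1) by auto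
  moreover have "list_mat f xs es \<in> carrier_mat (length xs) (length es)" by (simp add: list_mat_def)
  ultimately have "card {j. j < length es \<and> j \<in> J} \<le> vec_space.rank (length xs) (list_mat f xs es)"
    using vec_space.rank_gt_minor by blast
  moreover have "{j. j < length es \<and> j \<in> J} = J" by (auto simp: J_def)
  moreover have "inj_on ((!) es) J" using assms(2) by (auto simp: J_def intro: inj_on_nth)
  then have "card J = length ys" using im(2) distinct_card[OF assms(5)] by (metis card_image)
  ultimately show ?thesis by simp
qed

section \<open>Cycle weights and the vanishing of \<alpha>\<close>

lemma cycle_weight_nonzero:
  assumes G: "oriented_on V (parcs G)" "C \<in> cycles_in (parcs G)" "\<And>e. e \<in> parcs G \<Longrightarrow> w e \<noteq> 0"
  shows "cycle_weight G w C \<noteq> 0"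
proof -
  define q where "q = (SOME p. goes_around p C)"
  have q: "goes_around q C" using G(2) unfolding q_def cycles_in_def by (auto intro: someI)
  have "adj_weight G w (q ! s) (q ! Suc s) \<noteq> 0" if "s < length q - 1" for s
  proof -
    have "(q ! s, q ! Suc s) \<in> set (vwalk_arcs q)" using that by (auto simp: set_vwalk_arcs)
    then have "(q ! s, q ! Suc s) \<in> parcs C \<union> (parcs C)\<inverse>" using q unfolding goes_around_iff by blast
    then have "(q ! s, q ! Suc s) \<in> parcs G \<union> (parcs G)\<inverse>" using G(2) by (auto simp: cycles_in_def)
    then show ?thesis using G(3) by (auto simp: adj_weight_def)
  qed
  then show ?thesis unfolding cycle_weight_def walk_weight_def q_def[symmetric] by simp
qed

lemma cmod_eq_Re_iff: "z \<noteq> 0 \<Longrightarrow> cmod z = Re z \<longleftrightarrow> z \<in> pos_reals"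
proof
  assume "z \<noteq> 0" "cmod z = Re z"
  then have "Im z = 0" using cmod_power2[of z] by simp
  then have "z = complex_of_real (cmod z)" using \<open>cmod z = Re z\<close> by (simp add: complex_eq_iff)
  then show "z \<in> pos_reals" using \<open>z \<noteq> 0\<close> unfolding pos_reals_def by (metis greaterThan_iff image_eqI zero_less_norm_iff)
qed (auto simp: pos_reals_def)

text \<open>Among non-zero numbers |z| = Re z singles out the positive reals; the odd case is the
  same statement for -z.\<close>

lemma cycle_alpha_eq_0_iff:
  assumes "cycle_weight G w C \<noteq> 0"
  shows "cycle_alpha G w C = 0 \<longleftrightarrow>
    (if even (card (parcs C)) then cycle_weight G w C \<in> pos_reals else cycle_weight G w C \<in> neg_reals)"
proof -
  have "z \<in> neg_reals \<longleftrightarrow> - z \<in> pos_reals" for z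
  proof
    assume "z \<in> neg_reals"
    then obtain x where "x < 0" "z = complex_of_real x" by (auto simp: neg_reals_def)
    then have "- z = complex_of_real (- x)" "- x \<in> {0<..}" by simp_all
    then show "- z \<in> pos_reals" unfolding pos_reals_def by blast
  next
    assume "- z \<in> pos_reals"
    then obtain x where "x > 0" "- z = complex_of_real x" by (auto simp: pos_reals_def)
    then have "z = complex_of_real (- x)" "- x \<in> {..<0}"
      by (metis minus_minus of_real_minus) (use \<open>x > 0\<close> in simp)
    then show "z \<in> neg_reals" unfolding neg_reals_def by blast
  qed
  moreover have "cmod z + Re z = 0 \<longleftrightarrow> cmod (- z) = Re (- z)" for z by (simp add: add_eq_0_iff2)
  ultimately show ?thesis
    using cmod_eq_Re_iff[OF assms] cmod_eq_Re_iff[of "- cycle_weight G w C"] assms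
    unfolding cycle_alpha_def by simp
qed


section \<open>The two formulas\<close>

lemma pseudoforest_weight_nonzero_iff:
  assumes "oriented_on V F" "\<And>e. e \<in> F \<Longrightarrow> w e \<noteq> 0"
  shows "pseudoforest_weight G w F \<noteq> 0 \<longleftrightarrow> (\<forall>C\<in>cycles_in F. cycle_alpha G w C \<noteq> 0)"
  using assms(2) oriented_on_finite(2)[OF assms(1)] finite_cycles_in[OF assms(1)] by (auto simp: pseudoforest_weight_def)

lemma sum_spanning_subgraphs:
  "(\<Sum>T\<in>{T :: 'a pair_pre_digraph. pverts T = V \<and> parcs T \<subseteq> E \<and> P (parcs T)}. g (parcs T)) = (\<Sum>F | F \<subseteq> E \<and> P F. g F)"
  for g :: "'a rel \<Rightarrow> real"
  by (rule sum.reindex_bij_witness[where i = "\<lambda>F. \<lparr>pverts = V, parcs = F\<rparr>" and j = parcs]) auto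

context
  fixes n :: nat and G :: "nat pair_pre_digraph" and w :: "nat \<times> nat \<Rightarrow> complex" and es :: "(nat \<times> nat) list"
  assumes G: "oriented_on (pverts G) (parcs G)" and con: "weakly_connected G"
    and V: "pverts G = {0..<n}" and n: "2 \<le> n"
    and es: "set es = parcs G" "distinct es"
    and weights: "\<forall>e\<in>parcs G. w e \<noteq> 0 \<and> w e \<notin> neg_reals"
begin

lemma weightD: "e \<in> parcs G \<Longrightarrow> w e \<noteq> 0" "e \<in> parcs G \<Longrightarrow> w e \<notin> neg_reals"
  using weights by auto

lemma signless_incidence_list_mat:
  "signless_incidence n es w = list_mat (incidence_entry w) [0..<n] es"
  by (rule eq_matI) (auto simp: signless_incidence_def list_mat_def incidence_entry_def)

lemma joined_G: "x \<in> pverts G \<Longrightarrow> y \<in> pverts G \<Longrightarrow> (x, y) \<in> joined (parcs G)"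
  using con G by (subst (asm) weakly_connected_iff) (auto simp: oriented_on_def)

lemma oriented_on_sub: "F \<subseteq> parcs G \<Longrightarrow> oriented_on (pverts G) F"
  using G unfolding oriented_on_def by blast

text \<open>The omitted rows are the roots, and squareness supplies the arc count under which a
  non-zero minor must come from a pseudoforest.\<close>

lemma minor:
  assumes "distinct xs" "set xs \<subseteq> pverts G" "distinct ys" "set ys \<subseteq> parcs G" "length xs = length ys"
  shows "(cmod (det (list_mat (incidence_entry w) xs ys)))\<^sup>2 =
    (if pseudoforest (pverts G - set xs) (pverts G) (set ys) then pseudoforest_weight G w (set ys) else 0)"
proof -
  let ?R = "pverts G - set xs"
  have fin: "finite (pverts G)" by (simp add: V)
  have sx: "set xs = pverts G - ?R" using assms(2) by auto
  show ?thesis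
  proof (cases "pseudoforest ?R (pverts G) (set ys)")
    case True
    then show ?thesis using pseudoforest_det[OF G weightD(2) True assms(4,1) sx assms(3) refl] by simp
  next
    case False
    have "card (set ys) = card (set xs)"
      using distinct_card[OF assms(1)] distinct_card[OF assms(3)] assms(5) by simp
    then have "card (set ys) + card ?R = card (pverts G)"
      using card_Diff_subset[of "set xs" "pverts G"] card_mono[OF fin assms(2)] assms(2) by simp
    then have "det (list_mat (incidence_entry w) xs ys) = 0"
      using det_nonzero_imp_pseudoforest[where w = w, OF G weightD(2) oriented_on_sub[OF assms(4)] _ assms(4) _ assms(1) sx assms(3) refl] False
      by blast
    then show ?thesis using False by simp
  qed
qed

text \<open>A non-zero weight is a non-vanishing minor with one row for each vertex that is not a
  root.\<close>

lemma rank_ge_pseudoforest: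
  assumes "pseudoforest R (pverts G) F" "F \<subseteq> parcs G" "pseudoforest_weight G w F \<noteq> 0"
  shows "n - card R \<le> vec_space.rank n (signless_incidence n es w)"
proof -
  have R: "R \<subseteq> pverts G" "finite R" using pseudoforest_orient[OF assms(1)] finite_subset[of R "pverts G"] V by auto
  obtain xs where xs: "distinct xs" "set xs = pverts G - R"
    using finite_distinct_list[of "pverts G - R"] V by auto
  obtain ys where ys: "distinct ys" "set ys = F"
    using finite_distinct_list[of F] oriented_on_finite(2)[OF oriented_on_sub[OF assms(2)]] by auto
  have "(cmod (det (list_mat (incidence_entry w) xs ys)))\<^sup>2 = pseudoforest_weight G w F"
    by (rule pseudoforest_det[OF G weightD(2) assms(1,2) xs ys])
  then have "det (list_mat (incidence_entry w) xs ys) \<noteq> 0" using assms(3) by auto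
  then have "length ys \<le> vec_space.rank (length [0..<n]) (list_mat (incidence_entry w) [0..<n] es)"
    by (intro rank_list_mat_ge[OF _ es(2) xs(1) _ ys(1)]) (use xs(2) ys(2) V es(1) assms(2) in auto)
  moreover have "length ys = n - card R"
    using pseudoforest_card[OF assms(1)] distinct_card[OF ys(1)] ys(2) V by simp
  ultimately show ?thesis unfolding signless_incidence_list_mat by simp
qed

lemma rank_le: "vec_space.rank n (signless_incidence n es w) \<le> n"
  using rank_list_mat(1)[of "[0..<n]" "incidence_entry w" es] unfolding signless_incidence_list_mat by simp

lemma rank_eqD:
  assumes "vec_space.rank n (signless_incidence n es w) = n"
  shows "\<exists>F\<subseteq>parcs G. pseudoforest {} (pverts G) F \<and> pseudoforest_weight G w F \<noteq> 0"
proof -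
  obtain ys where ys: "distinct ys" "set ys \<subseteq> set es" "length ys = n" "det (list_mat (incidence_entry w) [0..<n] ys) \<noteq> 0"
    using rank_list_mat(2)[of "[0..<n]" "incidence_entry w" es] assms unfolding signless_incidence_list_mat by auto
  have "(cmod (det (list_mat (incidence_entry w) [0..<n] ys)))\<^sup>2 =
    (if pseudoforest (pverts G - set [0..<n]) (pverts G) (set ys) then pseudoforest_weight G w (set ys) else 0)"
    using ys V es(1) by (intro minor) auto
  moreover have "pverts G - set [0..<n] = {}" using V by simp
  moreover have "(cmod (det (list_mat (incidence_entry w) [0..<n] ys)))\<^sup>2 \<noteq> 0" using ys(4) by simp
  ultimately show ?thesis using ys(2) es(1) by (intro exI[of _ "set ys"]) (metis)
qed

lemma vol2_eq:
  assumes "vec_space.rank n (signless_incidence n es w) = r"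
  shows "vol2 (signless_incidence n es w) = (\<Sum>X | X \<subseteq> pverts G \<and> card X = r. \<Sum>F | F \<subseteq> parcs G \<and> card F = r.
    if pseudoforest (pverts G - X) (pverts G) F then pseudoforest_weight G w F else 0)"
proof -
  have "vol2 (signless_incidence n es w) = (\<Sum>X | X \<subseteq> set [0..<n] \<and> card X = r. \<Sum>F | F \<subseteq> set es \<and> card F = r.
    if pseudoforest (pverts G - X) (pverts G) F then pseudoforest_weight G w F else 0)"
    unfolding signless_incidence_list_mat
  proof (rule vol2_list_mat)
    show "vec_space.rank (length [0..<n]) (list_mat (incidence_entry w) [0..<n] es) = r"
      using assms unfolding signless_incidence_list_mat by simp
  next
    fix xs' ys
    assume "distinct xs'" "set xs' \<subseteq> set [0..<n]" "distinct ys" "set ys \<subseteq> set es"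
      "length xs' = r" "length ys = r"
    then show "(cmod (det (list_mat (incidence_entry w) xs' ys)))\<^sup>2 =
      (if pseudoforest (pverts G - set xs') (pverts G) (set ys) then pseudoforest_weight G w (set ys) else 0)"
      by (intro minor) (simp_all add: V es(1))
  qed (use es(2) in simp_all)
  then show ?thesis using V es(1) by simp
qed

lemma vol2_balanced:
  assumes "\<And>C. C \<in> cycles_in (parcs G) \<Longrightarrow> cycle_alpha G w C = 0"
  shows "vol2 (signless_incidence n es w) = real n * (\<Sum>T\<in>oriented_spanning_trees G. cmod (weight_product w T))"
proof -
  \<comment> \<open>Each cycle contributes a zero factor, and all other factors are
    non-zero.\<close>
  have zero: "pseudoforest_weight G w F = 0 \<longleftrightarrow> cycles_in F \<noteq> {}" if F: "F \<subseteq> parcs G" for F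
  proof -
    have "cycles_in F \<subseteq> cycles_in (parcs G)" by (rule cycles_in_mono[OF F])
    then have "\<forall>C\<in>cycles_in F. cycle_alpha G w C = 0" using assms by blast
    moreover have "pseudoforest_weight G w F \<noteq> 0 \<longleftrightarrow> (\<forall>C\<in>cycles_in F. cycle_alpha G w C \<noteq> 0)"
      using F weightD(1) by (intro pseudoforest_weight_nonzero_iff[OF oriented_on_sub[OF F]]) blast
    ultimately show ?thesis by auto
  qed
  \<comment> \<open>A spanning tree grown from vertex 0 provides the lower bound n - 1 for the
    rank.\<close>
  have "\<exists>F. pseudoforest {0} (pverts G) F \<and> F \<subseteq> parcs G \<and> cycles_in F = cycles_in {}"
    by (rule pseudoforest_extend[OF G joined_G pseudoforest.base]) (use V n in auto)
  then obtain F0 where F0: "pseudoforest {0} (pverts G) F0" "F0 \<subseteq> parcs G" "cycles_in F0 = {}"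
    using cycles_in_empty by metis
  have "n - 1 \<le> vec_space.rank n (signless_incidence n es w)" using rank_ge_pseudoforest[OF F0(1,2)] zero[OF F0(2)] F0(3) by simp
  moreover have "vec_space.rank n (signless_incidence n es w) \<noteq> n"
  proof
    assume "vec_space.rank n (signless_incidence n es w) = n"
    then obtain F where F: "F \<subseteq> parcs G" "pseudoforest {} (pverts G) F" "pseudoforest_weight G w F \<noteq> 0" using rank_eqD by blast
    \<comment> \<open>Vertex 0 must reach a core of the rootless \<open>F\<close>, and that core can
      only be a cycle.\<close>
    have "0 \<in> pverts G" using V n by simp
    then obtain C where "C \<in> cycles_in F"
      using pseudoforest_imp_one_core[OF F(2)] unfolding one_core_def cores_def by blast
    then show False using F zero by blast
  qed
  ultimately have rk: "vec_space.rank n (signless_incidence n es w) = n - 1" using rank_le n by linarith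
  have cV: "card (pverts G) = n" "finite (pverts G)" using V by simp_all
  have trees: "(\<Sum>F | F \<subseteq> parcs G \<and> card F = n - 1. if pseudoforest {r} (pverts G) F then pseudoforest_weight G w F else 0) =
    (\<Sum>T\<in>oriented_spanning_trees G. cmod (weight_product w T))" if r: "r \<in> pverts G" for r
  proof -
    have finE: "finite {F. F \<subseteq> parcs G \<and> card F = n - 1}"
      using oriented_on_finite(2)[OF G] by (auto intro: finite_subset[of _ "Pow (parcs G)"])
    have "(\<Sum>F | F \<subseteq> parcs G \<and> card F = n - 1. if pseudoforest {r} (pverts G) F then pseudoforest_weight G w F else 0) =
      (\<Sum>F | F \<subseteq> parcs G \<and> pseudoforest {r} (pverts G) F \<and> cycles_in F = {}. \<Prod>e\<in>F. cmod (w e))"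
    proof (rule sum.mono_neutral_cong_right[OF finE])
      show "{F. F \<subseteq> parcs G \<and> pseudoforest {r} (pverts G) F \<and> cycles_in F = {}} \<subseteq> {F. F \<subseteq> parcs G \<and> card F = n - 1}"
      proof
        fix F assume "F \<in> {F. F \<subseteq> parcs G \<and> pseudoforest {r} (pverts G) F \<and> cycles_in F = {}}"
        then show "F \<in> {F. F \<subseteq> parcs G \<and> card F = n - 1}" using pseudoforest_card[of "{r}" "pverts G" F] cV by simp
      qed
    qed (use zero in \<open>auto simp: pseudoforest_weight_def\<close>)
    also have "\<dots> = (\<Sum>T\<in>{T :: nat pair_pre_digraph. pverts T = pverts G \<and> parcs T \<subseteq> parcs G \<and>
      (pseudoforest {r} (pverts G) (parcs T) \<and> cycles_in (parcs T) = {})}. \<Prod>e\<in>parcs T. cmod (w e))"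
      by (rule sum_spanning_subgraphs[symmetric])
    also have "\<dots> = (\<Sum>T\<in>oriented_spanning_trees G. cmod (weight_product w T))"
      by (rule sum.cong) (auto simp: oriented_spanning_tree_iff[OF G r] weight_product_def prod_norm)
    finally show ?thesis .
  qed
  have "vol2 (signless_incidence n es w) = (\<Sum>X | X \<subseteq> pverts G \<and> card X = n - 1. \<Sum>F | F \<subseteq> parcs G \<and> card F = n - 1.
    if pseudoforest (pverts G - X) (pverts G) F then pseudoforest_weight G w F else 0)"
    by (rule vol2_eq[OF rk])
  \<comment> \<open>Row sets of size n - 1 are the complements of single vertices, which gives n
    inner sums, all equal by \<open>trees\<close>.\<close>
  also have "{X. X \<subseteq> pverts G \<and> card X = n - 1} = (\<lambda>r. pverts G - {r}) ` pverts G"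
  proof (intro equalityI subsetI)
    fix X assume "X \<in> {X. X \<subseteq> pverts G \<and> card X = n - 1}"
    then have X: "X \<subseteq> pverts G" "card X = n - 1" by auto
    have "card (pverts G - X) = 1"
      using X cV n card_Diff_subset[OF finite_subset[OF X(1) cV(2)] X(1)] by simp
    then obtain r where r: "pverts G - X = {r}" by (auto simp: card_1_singleton_iff)
    then have "X = pverts G - {r}" "r \<in> pverts G" using X(1) by blast+
    then show "X \<in> (\<lambda>r. pverts G - {r}) ` pverts G" by blast
  qed (use cV in auto)
  also have "(\<Sum>X\<in>(\<lambda>r. pverts G - {r}) ` pverts G. \<Sum>F | F \<subseteq> parcs G \<and> card F = n - 1.
      if pseudoforest (pverts G - X) (pverts G) F then pseudoforest_weight G w F else 0) =
    (\<Sum>r\<in>pverts G. \<Sum>F | F \<subseteq> parcs G \<and> card F = n - 1. if pseudoforest {r} (pverts G) F then pseudoforest_weight G w F else 0)"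
  proof (subst sum.reindex)
    show "inj_on (\<lambda>r. pverts G - {r}) (pverts G)" by (rule inj_onI) blast
  qed (auto intro!: sum.cong simp: Diff_Diff_Int)
  also have "\<dots> = (\<Sum>r\<in>pverts G. \<Sum>T\<in>oriented_spanning_trees G. cmod (weight_product w T))"
    by (rule sum.cong[OF refl trees])
  finally show ?thesis using cV by simp
qed

lemma vol2_unbalanced:
  assumes "C \<in> cycles_in (parcs G)" "cycle_alpha G w C \<noteq> 0"
  shows "vol2 (signless_incidence n es w) = (\<Sum>H\<in>unicyclic_spanning_subgraphs G. \<Prod>U\<in>weak_components H.
    2 * cmod (weight_product w (remove_edges U (the_cycle U))) * cycle_alpha G w (the_cycle U))"
proof -
  obtain p where p: "goes_around p C" "parcs C \<subseteq> parcs G" using assms(1) by (auto simp: cycles_in_def)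
  have oC: "oriented_on (pverts C) (parcs C)" by (rule cycles_in_orient[OF assms(1) G])
  have o0: "oriented_on {} {}" by (simp add: oriented_on_def)
  \<comment> \<open>\<open>C\<close> alone is the seed; growth adds only pendant arcs, so
    \<open>C\<close> stays the only cycle and the weight of the result is non-zero.\<close>
  have "pseudoforest {} ({} \<union> pverts C) ({} \<union> parcs C)"
    by (rule pseudoforest.cycle[OF pseudoforest.base p(1) oC]) auto
  then have "\<exists>F. pseudoforest {} (pverts G) F \<and> F \<subseteq> parcs G \<and> cycles_in F = cycles_in (parcs C)"
    using cycles_in_pverts_subset[OF assms(1) G] cycles_in_pverts_nonempty[OF assms(1)] p(2)
    by (intro pseudoforest_extend[OF G joined_G]) auto
  moreover have "cycles_in (parcs C) = {C}" using disjoint_cycles_in(1)[OF o0 p(1) oC] by (simp add: cycles_in_empty)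
  ultimately obtain F0 where F0: "pseudoforest {} (pverts G) F0" "F0 \<subseteq> parcs G" "cycles_in F0 = {C}" by auto
  have "pseudoforest_weight G w F0 \<noteq> 0 \<longleftrightarrow> (\<forall>C\<in>cycles_in F0. cycle_alpha G w C \<noteq> 0)"
    using F0(2) weightD(1) by (intro pseudoforest_weight_nonzero_iff[OF oriented_on_sub[OF F0(2)]]) blast
  then have "n \<le> vec_space.rank n (signless_incidence n es w)" using rank_ge_pseudoforest[OF F0(1,2)] F0(3) assms(2) by simp
  then have rk: "vec_space.rank n (signless_incidence n es w) = n" using rank_le by simp
  have cV: "card (pverts G) = n" "finite (pverts G)" using V by simp_all
  \<comment> \<open>At full rank every row is kept, so the only root set is the empty one.\<close>
  have "{X. X \<subseteq> pverts G \<and> card X = n} = {pverts G}"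
    using cV card_subset_eq by auto
  then have "vol2 (signless_incidence n es w) = (\<Sum>F | F \<subseteq> parcs G \<and> card F = n. if pseudoforest {} (pverts G) F then pseudoforest_weight G w F else 0)"
    using vol2_eq[OF rk] by simp
  also have "\<dots> = (\<Sum>F | F \<subseteq> parcs G \<and> pseudoforest {} (pverts G) F. pseudoforest_weight G w F)"
  proof (rule sum.mono_neutral_cong_right)
    show "finite {F. F \<subseteq> parcs G \<and> card F = n}"
      using oriented_on_finite(2)[OF G] by (auto intro: finite_subset[of _ "Pow (parcs G)"])
    show "{F. F \<subseteq> parcs G \<and> pseudoforest {} (pverts G) F} \<subseteq> {F. F \<subseteq> parcs G \<and> card F = n}"
    proof
      fix F assume "F \<in> {F. F \<subseteq> parcs G \<and> pseudoforest {} (pverts G) F}"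
      then show "F \<in> {F. F \<subseteq> parcs G \<and> card F = n}" using pseudoforest_card[of "{}" "pverts G" F] cV by simp
    qed
  qed auto
  also have "\<dots> = (\<Sum>H\<in>{H :: nat pair_pre_digraph. pverts H = pverts G \<and> parcs H \<subseteq> parcs G \<and>
      pseudoforest {} (pverts G) (parcs H)}. pseudoforest_weight G w (parcs H))"
    by (rule sum_spanning_subgraphs[symmetric])
  also have "\<dots> = (\<Sum>H\<in>unicyclic_spanning_subgraphs G. \<Prod>U\<in>weak_components H.
    2 * cmod (weight_product w (remove_edges U (the_cycle U))) * cycle_alpha G w (the_cycle U))"
  proof (rule sum.cong)
    fix H assume "H \<in> unicyclic_spanning_subgraphs G"
    then have H: "pverts H = pverts G" "parcs H \<subseteq> parcs G" "pseudoforest {} (pverts G) (parcs H)"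
      unfolding unicyclic_spanning_subgraph_iff[OF G] by auto
    have o: "oriented_on (pverts H) (parcs H)" using oriented_on_sub[OF H(2)] H(1) by simp
    have "one_core {} (pverts H) (parcs H)" using pseudoforest_imp_one_core[OF H(3)] H(1) by simp
    from prod_components_eq_pseudoforest_weight[OF o this, of w G] show "pseudoforest_weight G w (parcs H) = (\<Prod>U\<in>weak_components H.
      2 * cmod (weight_product w (remove_edges U (the_cycle U))) * cycle_alpha G w (the_cycle U))"
      by simp
  qed (auto simp: unicyclic_spanning_subgraph_iff[OF G])
  finally show ?thesis .
qed

end

theorem theorem4p7:
  fixes n :: nat
    and G :: "nat pair_pre_digraph"
    and w :: "nat \<times> nat \<Rightarrow> complex"
    and es :: "(nat \<times> nat) list"
  assumes "oriented_graph G"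
    and "weakly_connected G"
    and "2 \<le> n"
    and "pverts G = {0..<n}"
    and "set es = parcs G" and "distinct es"
    and "\<exists>C. is_cycle_of C G"
    and "\<forall>e \<in> parcs G. w e \<noteq> 0 \<and> w e \<notin> neg_reals"
  shows
    "((\<forall>C. even_cycle_of C G \<longrightarrow> cycle_weight G w C \<in> pos_reals) \<and>
      (\<forall>C. odd_cycle_of C G \<longrightarrow> cycle_weight G w C \<in> neg_reals) \<longrightarrow>
        vol2 (signless_incidence n es w) =
          real n * (\<Sum>T \<in> oriented_spanning_trees G. cmod (weight_product w T))) \<and>
     ((\<exists>C. even_cycle_of C G \<and> cycle_weight G w C \<notin> pos_reals) \<or>
      (\<exists>C. odd_cycle_of C G \<and> cycle_weight G w C \<notin> neg_reals) \<longrightarrow>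
        vol2 (signless_incidence n es w) =
          (\<Sum>H \<in> unicyclic_spanning_subgraphs G. \<Prod>U \<in> weak_components H.
             2 * cmod (weight_product w (remove_edges U (the_cycle U))) *
             cycle_alpha G w (the_cycle U)))"
proof -
  have "pair_digraph G" and anti: "\<And>u v. (u, v) \<in> parcs G \<Longrightarrow> (v, u) \<notin> parcs G"
    using assms(1) by (auto simp: oriented_graph_def)
  then interpret pair_digraph G by simp
  have G: "oriented_on (pverts G) (parcs G)"
    unfolding oriented_on_def using pair_finite_verts wellformed' anti by auto
  \<comment> \<open>This turns the two cases into complementary ones: \<alpha> vanishes on every
    cycle, or is non-zero on some cycle.\<close>
  have alpha: "cycle_alpha G w C = 0 \<longleftrightarrow>
    (if even (card (parcs C)) then cycle_weight G w C \<in> pos_reals else cycle_weight G w C \<in> neg_reals)"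
    if "C \<in> cycles_in (parcs G)" for C
    by (rule cycle_alpha_eq_0_iff[OF cycle_weight_nonzero[OF G that]]) (use assms(8) in blast)
  note ctxt = G assms(2,4,3,5,6,8)
  show ?thesis
    unfolding is_cycle_of_iff[OF G]
  proof (intro conjI impI)
    assume "(\<forall>C. C \<in> cycles_in (parcs G) \<and> even (card (parcs C)) \<longrightarrow> cycle_weight G w C \<in> pos_reals) \<and>
      (\<forall>C. C \<in> cycles_in (parcs G) \<and> odd (card (parcs C)) \<longrightarrow> cycle_weight G w C \<in> neg_reals)"
    then have "cycle_alpha G w C = 0" if "C \<in> cycles_in (parcs G)" for C using alpha[OF that] that by simp
    then show "vol2 (signless_incidence n es w) =
        real n * (\<Sum>T \<in> oriented_spanning_trees G. cmod (weight_product w T))"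
      by (rule vol2_balanced[OF ctxt])
  next
    assume "(\<exists>C. (C \<in> cycles_in (parcs G) \<and> even (card (parcs C))) \<and> cycle_weight G w C \<notin> pos_reals) \<or>
      (\<exists>C. (C \<in> cycles_in (parcs G) \<and> odd (card (parcs C))) \<and> cycle_weight G w C \<notin> neg_reals)"
    then obtain C where "C \<in> cycles_in (parcs G)" "cycle_alpha G w C \<noteq> 0" using alpha by auto
    then show "vol2 (signless_incidence n es w) =
        (\<Sum>H \<in> unicyclic_spanning_subgraphs G. \<Prod>U \<in> weak_components H.
           2 * cmod (weight_product w (remove_edges U (the_cycle U))) *
           cycle_alpha G w (the_cycle U))"
      by (rule vol2_unbalanced[OF ctxt])
  qed
qed

end
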